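(* There exists an efficient (polynomial-time in $n$) algorithm which, given a non-negative symmetric submodular function $f\colon 2^{\mathcal{N}} \to \mathbb{R}^+$ (accessed via a value oracle), a down-monotone solvable polytope $\mathcal{P} \subseteq [0,1]^{\mathcal{N}}$ and a constant $T \geq 0$, finds a point $x \in [0,1]^{\mathcal{N}}$ such that \[ F(x) \geq \tfrac{1}{2}\left[1 - e^{-2T} - o(1)\right] \cdot \max\{F(x') : x' \in \mathcal{P} \cap \{0,1\}^{\mathcal{N}}\}. \] Additionally: (a) $x/T \in \mathcal{P}$; (b) letting $T_{\mathcal{P}} = -\ln(1 - d(\mathcal{P}) + n^{-4})/d(\mathcal{P})$, if $T \leq T_{\mathcal{P}}$ then $x \in \mathcal{P}$.
   Context: $\mathcal{N}$ is a finite ground set and $n = |\mathcal{N}|$. A set function $f\colon 2^{\mathcal{N}}\to\mathbb{R}$ is submodular if $f(A)+f(B)\ge f(A\cup B)+f(A\cap B)$ for all $A,B\subseteq\mathcal{N}$, and symmetric if $f(S)=f(\mathcal{N}\setminus S)$ for all $S\subseteq\mathcal{N}$. The multilinear extension of $f$ is $F\colon[0,1]^{\mathcal{N}}\to\mathbb{R}$, $F(x)=\mathbb{E}[f(R(x))]$, where $R(x)$ contains each $u\in\mathcal{N}$ independently with probability $x_u$. A value oracle returns $f(S)$ for a queried set $S$. A polytope $\mathcal{P}\subseteq[0,1]^{\mathcal{N}}$ is solvable if linear functions can be optimized over it efficiently, and down-monotone if $x\le y$ (coordinate-wise) and $y\in\mathcal{P}$ imply $x\in\mathcal{P}$. Density: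 consider representations of $\mathcal{P}$ by $m$ inequality constraints $\sum_{u}a_{i,u}x_u\le b_i$ in which all coefficients are non-negative and each constraint has at least one non-zero coefficient; the density $d(\mathcal{P})$ is the maximum over such representations of $\min_{1\le i\le m} b_i/\sum_{u\in\mathcal{N}}a_{i,u}$. The $o(1)$ term tends to $0$ as $n\to\infty$. *)

theory Defs
  imports "HOL-Probability.Probability" "HOL-Computational_Algebra.Polynomial"
begin

text \<open>
  The ground set with \<^term>\<open>n\<close> elements is \<^term>\<open>{..<n}\<close>, so that its elements can serve as
  array indices of an algorithm. Since \<^term>\<open>n\<close> tends to infinity, vectors over the ground set
  are extensional functions on \<^term>\<open>{..<n}\<close> rather than elements of a type of fixed dimension.
\<close>

definition nonnegative :: "nat \<Rightarrow> (nat set \<Rightarrow> real) \<Rightarrow> bool" where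
  "nonnegative n f \<longleftrightarrow> (\<forall>S\<subseteq>{..<n}. 0 \<le> f S)"

definition submodular :: "nat \<Rightarrow> (nat set \<Rightarrow> real) \<Rightarrow> bool" where
  "submodular n f \<longleftrightarrow>
     (\<forall>A\<subseteq>{..<n}. \<forall>B\<subseteq>{..<n}. f A + f B \<ge> f (A \<union> B) + f (A \<inter> B))"

definition symmetric :: "nat \<Rightarrow> (nat set \<Rightarrow> real) \<Rightarrow> bool" where
  "symmetric n f \<longleftrightarrow> (\<forall>S\<subseteq>{..<n}. f S = f ({..<n} - S))"

definition random_set :: "nat \<Rightarrow> (nat \<Rightarrow> real) \<Rightarrow> nat set pmf" where
  "random_set n x =
     map_pmf (\<lambda>\<omega>. {u \<in> {..<n}. \<omega> u}) (Pi_pmf {..<n} False (\<lambda>u. bernoulli_pmf (x u)))"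

definition multilinear :: "nat \<Rightarrow> (nat set \<Rightarrow> real) \<Rightarrow> (nat \<Rightarrow> real) \<Rightarrow> real" where
  "multilinear n f x = measure_pmf.expectation (random_set n x) f"

definition cube :: "nat \<Rightarrow> (nat \<Rightarrow> real) set" where
  "cube n = {..<n} \<rightarrow>\<^sub>E {0..1}"

definition cube_polytope :: "nat \<Rightarrow> (nat \<Rightarrow> real) set \<Rightarrow> bool" where
  "cube_polytope n P \<longleftrightarrow> P \<noteq> {} \<and> P \<subseteq> cube n \<and>
     (\<exists>m (a :: nat \<Rightarrow> nat \<Rightarrow> real) (b :: nat \<Rightarrow> real).
        P = {x \<in> {..<n} \<rightarrow>\<^sub>E UNIV. \<forall>i<m. (\<Sum>u<n. a i u * x u) \<le> b i})"

definition down_monotone :: "nat \<Rightarrow> (nat \<Rightarrow> real) set \<Rightarrow> bool" where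
  "down_monotone n P \<longleftrightarrow>
     (\<forall>x\<in>cube n. \<forall>y\<in>P. (\<forall>u<n. x u \<le> y u) \<longrightarrow> x \<in> P)"

text \<open>
  Inequalities with non-negative coefficients cannot express \<^term>\<open>x u \<ge> 0\<close>, so these constraints
  are left implicit. The upper bounds \<^term>\<open>x u \<le> 1\<close> are not: they must follow from the
  inequalities, as otherwise the density would be unbounded.
\<close>

definition nonneg_representation ::
    "nat \<Rightarrow> (nat \<Rightarrow> real) set \<Rightarrow> nat \<Rightarrow> (nat \<Rightarrow> nat \<Rightarrow> real) \<Rightarrow> (nat \<Rightarrow> real) \<Rightarrow> bool" where
  "nonneg_representation n P m a b \<longleftrightarrow> m \<ge> 1 \<and>
     (\<forall>i<m. (\<forall>u<n. a i u \<ge> 0) \<and> (\<exists>u<n. a i u \<noteq> 0)) \<and>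
     P = {x \<in> {..<n} \<rightarrow>\<^sub>E {0..}. \<forall>i<m. (\<Sum>u<n. a i u * x u) \<le> b i}"

definition polytope_density :: "nat \<Rightarrow> (nat \<Rightarrow> real) set \<Rightarrow> real" where
  "polytope_density n P = (GREATEST d. \<exists>m a b. nonneg_representation n P m a b \<and>
     d = Min ((\<lambda>i. b i / (\<Sum>u<n. a i u)) ` {..<m}))"

definition T_bound :: "nat \<Rightarrow> (nat \<Rightarrow> real) set \<Rightarrow> real" where
  "T_bound n P = - ln (1 - polytope_density n P + 1 / real n ^ 4) / polytope_density n P"

definition linear_optimizer ::
    "nat \<Rightarrow> (nat \<Rightarrow> real) set \<Rightarrow> ((nat \<Rightarrow> real) \<Rightarrow> (nat \<Rightarrow> real)) \<Rightarrow> bool" where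
  "linear_optimizer n P opt \<longleftrightarrow>
     (\<forall>w. opt w \<in> P \<and> (\<forall>y\<in>P. (\<Sum>u<n. w u * y u) \<le> (\<Sum>u<n. w u * opt w u)))"

text \<open>
  Algorithms are programs of a randomized real RAM with index variables over \<^typ>\<open>nat\<close>, arrays
  of reals, and two oracles. Every elementary instruction, test, loop iteration and oracle call
  costs one step. To keep unit cost realistic there is no rounding of reals to indices, no
  multiplication of indices, and the only constants are integers. All loops have an iteration
  count that is fixed on entry, hence every program terminates.
\<close>

datatype iexp = INum nat | IVar nat | IAdd iexp iexp | ISub iexp iexp

datatype rexp = RNum int | RIdx iexp | RCell nat iexp
  | RAdd rexp rexp | RSub rexp rexp | RMul rexp rexp | RDiv rexp rexp

datatype prog =
    ISet nat iexp
  | RSet nat iexp rexp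
  | Flip nat iexp rexp
  | Value nat iexp nat
  | Optimize nat nat
  | Seq prog prog
  | IfLe rexp rexp prog prog
  | For nat iexp prog

record state =
  idx :: "nat \<Rightarrow> nat"
  arr :: "nat \<Rightarrow> nat \<Rightarrow> real"
  steps :: nat

primrec ival :: "iexp \<Rightarrow> state \<Rightarrow> nat" where
  "ival (INum k) s = k"
| "ival (IVar v) s = idx s v"
| "ival (IAdd d e) s = ival d s + ival e s"
| "ival (ISub d e) s = ival d s - ival e s"

primrec rval :: "rexp \<Rightarrow> state \<Rightarrow> real" where
  "rval (RNum k) s = of_int k"
| "rval (RIdx e) s = real (ival e s)"
| "rval (RCell r e) s = arr s r (ival e s)"
| "rval (RAdd d e) s = rval d s + rval e s"
| "rval (RSub d e) s = rval d s - rval e s"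
| "rval (RMul d e) s = rval d s * rval e s"
| "rval (RDiv d e) s = rval d s / rval e s"

definition tick :: "state \<Rightarrow> state" where
  "tick s = s\<lparr>steps := Suc (steps s)\<rparr>"

definition set_idx :: "nat \<Rightarrow> nat \<Rightarrow> state \<Rightarrow> state" where
  "set_idx v k s = s\<lparr>idx := (idx s)(v := k)\<rparr>"

definition set_cell :: "nat \<Rightarrow> nat \<Rightarrow> real \<Rightarrow> state \<Rightarrow> state" where
  "set_cell r j z s = s\<lparr>arr := (arr s)(r := (arr s r)(j := z))\<rparr>"

definition read_vec :: "nat \<Rightarrow> nat \<Rightarrow> state \<Rightarrow> nat \<Rightarrow> real" where
  "read_vec n r s = (\<lambda>u\<in>{..<n}. arr s r u)"

definition write_vec :: "nat \<Rightarrow> nat \<Rightarrow> (nat \<Rightarrow> real) \<Rightarrow> state \<Rightarrow> state" where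
  "write_vec n r x s =
     s\<lparr>arr := (arr s)(r := (\<lambda>u. if u < n then x u else arr s r u))\<rparr>"

text \<open>
  \<^term>\<open>Flip r e p\<close> stores the outcome of a coin with success probability \<^term>\<open>p\<close> (clipped to
  the unit interval), \<^term>\<open>Value r e q\<close> stores the value of \<^term>\<open>f\<close> at the set whose indicator
  vector is in array \<^term>\<open>q\<close>, and \<^term>\<open>Optimize r q\<close> overwrites array \<^term>\<open>r\<close> by a point
  maximizing the linear function with the weights in array \<^term>\<open>q\<close>.
\<close>

primrec run :: "nat \<Rightarrow> (nat set \<Rightarrow> real) \<Rightarrow> ((nat \<Rightarrow> real) \<Rightarrow> (nat \<Rightarrow> real)) \<Rightarrow>
    prog \<Rightarrow> state \<Rightarrow> state pmf" where
  "run n f opt (ISet v e) s = return_pmf (tick (set_idx v (ival e s) s))"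
| "run n f opt (RSet r e d) s = return_pmf (tick (set_cell r (ival e s) (rval d s) s))"
| "run n f opt (Flip r e p) s =
     map_pmf (\<lambda>c. tick (set_cell r (ival e s) (of_bool c) s)) (bernoulli_pmf (rval p s))"
| "run n f opt (Value r e q) s =
     return_pmf (tick (set_cell r (ival e s) (f {u \<in> {..<n}. arr s q u = 1}) s))"
| "run n f opt (Optimize r q) s = return_pmf (tick (write_vec n r (opt (read_vec n q s)) s))"
| "run n f opt (Seq c d) s = bind_pmf (run n f opt c s) (run n f opt d)"
| "run n f opt (IfLe d e c1 c2) s =
     (if rval d s \<le> rval e s then run n f opt c1 (tick s) else run n f opt c2 (tick s))"
| "run n f opt (For v e c) s =
     fold (\<lambda>j M. bind_pmf M (\<lambda>s'. run n f opt c (tick (set_idx v j s'))))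
       [0..<ival e s] (return_pmf (tick s))"

text \<open>
  On input, index variable 0 holds \<^term>\<open>n\<close> and cell 0 of array 0 holds \<^term>\<open>T\<close>; the resulting
  point is read off from array 1.
\<close>

definition init :: "nat \<Rightarrow> real \<Rightarrow> state" where
  "init n T = \<lparr>idx = (\<lambda>_. 0)(0 := n), arr = (\<lambda>_ _. 0)(0 := (\<lambda>_. 0)(0 := T)), steps = 0\<rparr>"

definition result :: "nat \<Rightarrow> state \<Rightarrow> nat \<Rightarrow> real" where
  "result n s = read_vec n 1 s"

end

theory Submission
  imports Defs
begin

text \<open>
  A discretized measured continuous greedy algorithm with time step \<open>d = T / n\<^sup>4\<close>. Write \<open>D\<^sub>u\<close> for the
  partial derivatives of the multilinear extension \<open>F\<close> at the current point \<open>y\<close>. The algorithm moves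
  coordinate \<open>u\<close> by \<open>d (1 - y\<^sub>u) x\<^sub>u\<close> if \<open>D\<^sub>u \<ge> 0\<close> and by \<open>- d y\<^sub>u\<close> if \<open>D\<^sub>u < 0\<close>, where \<open>x\<close> maximizes
  the weights \<open>(1 - y\<^sub>u) D\<^sub>u\<close> over the polytope. For an optimal set \<open>B\<close>, submodularity gives
  \<open>\<Sum>\<^bsub>u\<in>B\<^esub> (1 - y\<^sub>u) D\<^sub>u \<ge> \<bbbE> f(R \<union> B) - F y\<close> and \<open>- \<Sum>\<^bsub>u\<in>B\<^esub> y\<^sub>u D\<^sub>u \<ge> \<bbbE> f(R - B) - F y\<close>, while
  symmetry gives \<open>f(R \<union> B) + f(R - B) \<ge> f B\<close>. Hence the gain per step is about \<open>d (f B - 2 F y)\<close>,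
  and after \<open>n\<^sup>4\<close> steps \<open>F y\<close> is about \<open>(1 - exp (- 2 T)) f B / 2\<close>.

  The derivatives are estimated by sampling; Chebyshev's inequality and a union bound control the
  failure probability. As \<open>y\<^sub>u \<le> 1 - exp (- c\<^sub>u)\<close> with \<open>c / T\<close> an average of points of the polytope,
  \<open>y / T\<close> lies in the polytope, and for \<open>T \<le> T\<^sub>P\<close> concavity gives the same for \<open>y\<close>.
\<close>

section \<open>The multilinear extension\<close>

lemma expectation_bind_pmf:
  fixes h :: "'b \<Rightarrow> real"
  assumes "finite (set_pmf M)" "\<And>x. x \<in> set_pmf M \<Longrightarrow> finite (set_pmf (K x))"
  shows "measure_pmf.expectation (bind_pmf M K) h
    = measure_pmf.expectation M (\<lambda>x. measure_pmf.expectation (K x) h)"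
  using assms pmf_expectation_bind[of "set_pmf M" K M h]
  by (subst integral_measure_pmf[of "set_pmf M"]) auto

lemma expectation_pmf_mono:
  fixes g h :: "'a \<Rightarrow> real"
  assumes "finite (set_pmf M)" "\<And>x. x \<in> set_pmf M \<Longrightarrow> g x \<le> h x"
  shows "measure_pmf.expectation M g \<le> measure_pmf.expectation M h"
  using assms
  by (intro integral_mono_AE integrable_measure_pmf_finite) (auto simp: AE_measure_pmf_iff)

lemma random_set_0: "random_set 0 y = return_pmf {}"
  by (simp add: random_set_def map_pmf_def bind_return_pmf)

text \<open>Peels off the last element, which permits induction on the size of the ground set. It is
  also the order in which the coin-flipping loop of the algorithm builds the set.\<close>

lemma random_set_Suc:
  "random_set (Suc n) y =
     bind_pmf (random_set n y)
       (\<lambda>S. map_pmf (\<lambda>c. if c then insert n S else S) (bernoulli_pmf (y n)))"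
proof -
  let ?P = "Pi_pmf {..<n} False (\<lambda>u. bernoulli_pmf (y u))"
  have eq: "{u. u < Suc n \<and> (w(n := c)) u} =
      (if c then insert n {u. u < n \<and> w u} else {u. u < n \<and> w u})" for w c
    by auto
  have "random_set (Suc n) y =
      bind_pmf (bernoulli_pmf (y n)) (\<lambda>c. bind_pmf ?P (\<lambda>w. return_pmf
        {u. u < Suc n \<and> (w(n := c)) u}))"
    unfolding random_set_def lessThan_Suc
    by (subst Pi_pmf_insert') (auto simp: map_bind_pmf less_Suc_eq_le le_less disj_commute)
  also have "\<dots> = bind_pmf ?P (\<lambda>w. bind_pmf (bernoulli_pmf (y n)) (\<lambda>c. return_pmf
        (if c then insert n {u. u < n \<and> w u} else {u. u < n \<and> w u})))"
    unfolding eq by (rule bind_commute_pmf)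
  also have "\<dots> = bind_pmf (random_set n y)
       (\<lambda>S. map_pmf (\<lambda>c. if c then insert n S else S) (bernoulli_pmf (y n)))"
    by (simp add: random_set_def map_pmf_def bind_assoc_pmf bind_return_pmf cong: if_cong)
  finally show ?thesis .
qed

lemma set_pmf_random_set: "set_pmf (random_set n y) \<subseteq> Pow {..<n}"
  by (auto simp: random_set_def)

lemma finite_set_pmf_random_set [simp]: "finite (set_pmf (random_set n y))"
  using set_pmf_random_set by (rule finite_subset) simp

lemma integrable_random_set [simp]:
  fixes g :: "nat set \<Rightarrow> real"
  shows "integrable (measure_pmf (random_set n y)) g"
  by (simp add: integrable_measure_pmf_finite)

lemma multilinear_0: "multilinear 0 g y = g {}"
  by (simp add: multilinear_def random_set_0)

text \<open>The bounds on \<open>y n\<close> matter because \<open>bernoulli_pmf\<close> clips its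
  parameter to the unit interval.\<close>

lemma multilinear_Suc:
  assumes "0 \<le> y n" "y n \<le> 1"
  shows "multilinear (Suc n) g y =
    y n * multilinear n (\<lambda>S. g (insert n S)) y + (1 - y n) * multilinear n g y"
  using assms
  by (simp add: multilinear_def random_set_Suc expectation_bind_pmf mult.commute)

lemma multilinear_mono:
  assumes "\<And>S. S \<subseteq> {..<n} \<Longrightarrow> g S \<le> h S"
  shows "multilinear n g y \<le> multilinear n h y"
  unfolding multilinear_def
  by (rule expectation_pmf_mono) (use assms set_pmf_random_set[of n y] in auto)

lemma multilinear_cong:
  assumes "\<And>S. S \<subseteq> {..<n} \<Longrightarrow> g S = h S" "\<And>u. u < n \<Longrightarrow> y u = z u"
  shows "multilinear n g y = multilinear n h z"
proof -
  have "random_set n y = random_set n z"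
    unfolding random_set_def using assms(2) by (intro arg_cong[where f = "map_pmf _"] Pi_pmf_cong) auto
  moreover have "multilinear n g z = multilinear n h z"
    by (rule antisym; rule multilinear_mono) (simp_all add: assms(1))
  ultimately show ?thesis by (simp add: multilinear_def)
qed

lemma multilinear_const [simp]: "multilinear n (\<lambda>_. c) y = c"
  by (simp add: multilinear_def)

lemma multilinear_add:
  "multilinear n (\<lambda>S. g S + h S) y = multilinear n g y + multilinear n h y"
  by (simp add: multilinear_def)

lemma multilinear_diff:
  "multilinear n (\<lambda>S. g S - h S) y = multilinear n g y - multilinear n h y"
  by (simp add: multilinear_def)

lemma multilinear_cmult: "multilinear n (\<lambda>S. c * g S) y = c * multilinear n g y"
  by (simp add: multilinear_def)

lemma multilinear_sum:
  "multilinear n (\<lambda>S. \<Sum>u\<in>A. g u S) y = (\<Sum>u\<in>A. multilinear n (g u) y)"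
  by (simp add: multilinear_def)

lemma multilinear_bounds:
  assumes "\<And>S. S \<subseteq> {..<n} \<Longrightarrow> a \<le> g S" "\<And>S. S \<subseteq> {..<n} \<Longrightarrow> g S \<le> b"
  shows "a \<le> multilinear n g y" "multilinear n g y \<le> b"
  using multilinear_mono[of n "\<lambda>_. a" g y] multilinear_mono[of n g "\<lambda>_. b" y] assms by auto

lemma multilinear_abs_le:
  assumes "\<And>S. S \<subseteq> {..<n} \<Longrightarrow> \<bar>g S\<bar> \<le> M"
  shows "\<bar>multilinear n g y\<bar> \<le> M"
  using multilinear_bounds[of n "- M" g M y] assms by (simp add: abs_le_iff minus_le_iff)

section \<open>Dependence on single coordinates, partial derivatives and Taylor bounds\<close>

abbreviation fractional :: "nat \<Rightarrow> (nat \<Rightarrow> real) \<Rightarrow> bool" where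
  "fractional n y \<equiv> \<forall>u<n. 0 \<le> y u \<and> y u \<le> 1"

text \<open>The extension is affine in each coordinate: condition on whether \<open>k\<close> is
  drawn. The two expectations on the right ignore the old value of \<open>y k\<close>, since
  \<open>insert k S\<close> and \<open>S - {k}\<close> forget whether \<open>k\<close> was in
  \<open>S\<close>.\<close>

lemma multilinear_upd:
  assumes "k < n" "0 \<le> t" "t \<le> 1" "fractional n y"
  shows "multilinear n g (y(k := t)) =
    t * multilinear n (\<lambda>S. g (insert k S)) y + (1 - t) * multilinear n (\<lambda>S. g (S - {k})) y"
  using assms
proof (induction n arbitrary: g)
  case (Suc n)
  have yn: "0 \<le> y n" "y n \<le> 1" using Suc.prems by auto
  show ?case
  proof (cases "k = n")
    case True
    have 1: "multilinear n h (y(n := t)) = multilinear n h y" for h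
      by (rule multilinear_cong) auto
    have 2: "multilinear n (\<lambda>S. h (S - {n})) y = multilinear n h y" for h
      by (rule multilinear_cong) (auto intro!: arg_cong[where f = h])
    have "multilinear (Suc n) g (y(n := t)) =
        t * multilinear n (\<lambda>S. g (insert n S)) y + (1 - t) * multilinear n g y"
      using Suc.prems 1 by (subst multilinear_Suc) auto
    moreover have "multilinear (Suc n) (\<lambda>S. g (S - {n})) y = multilinear n g y"
      using yn 2[of g] by (simp add: multilinear_Suc algebra_simps)
    moreover have "multilinear (Suc n) (\<lambda>S. g (insert n S)) y = multilinear n (\<lambda>S. g (insert n S)) y"
      using yn by (simp add: multilinear_Suc algebra_simps)
    ultimately show ?thesis unfolding True by (simp only:)
  next
    case False
    then have kn: "k < n" using Suc.prems by auto
    have 3: "insert n S - {k} = insert n (S - {k})" for S using False by auto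
    have IH: "multilinear n h (y(k := t)) =
      t * multilinear n (\<lambda>S. h (insert k S)) y + (1 - t) * multilinear n (\<lambda>S. h (S - {k})) y" for h
      using Suc.IH[OF kn] Suc.prems by (simp add: fun_upd_def)
    show ?thesis
      using yn kn by (simp add: multilinear_Suc IH[unfolded fun_upd_def] 3 insert_commute[of k n] algebra_simps)
  qed
qed simp

text \<open>For \<open>k < n\<close> and fractional \<open>y\<close> this is the partial derivative
  of the extension in coordinate \<open>k\<close>. As an expectation it can be estimated by
  sampling.\<close>

definition marginal :: "nat \<Rightarrow> (nat set \<Rightarrow> real) \<Rightarrow> nat \<Rightarrow> (nat \<Rightarrow> real) \<Rightarrow> real" where
  "marginal n g k y = multilinear n (\<lambda>S. g (insert k S) - g (S - {k})) y"

lemma multilinear_split: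
  assumes "k < n" "fractional n y"
  shows "multilinear n g y =
    y k * multilinear n (\<lambda>S. g (insert k S)) y + (1 - y k) * multilinear n (\<lambda>S. g (S - {k})) y"
  using multilinear_upd[of k n "y k" y g] assms by simp

lemma multilinear_upd_diff:
  assumes "k < n" "0 \<le> t" "t \<le> 1" "fractional n y"
  shows "multilinear n g (y(k := t)) - multilinear n g y = (t - y k) * marginal n g k y"
  using multilinear_upd[OF assms, where g = g] multilinear_split[OF assms(1,4), where g = g]
  by (simp add: marginal_def multilinear_diff algebra_simps)

lemma multilinear_insert_gain:
  assumes "k < n" "fractional n y"
  shows "multilinear n (\<lambda>S. g (insert k S) - g S) y = (1 - y k) * marginal n g k y"
  using multilinear_split[OF assms, where g = g]
  by (simp add: marginal_def multilinear_diff algebra_simps)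

lemma multilinear_remove_loss:
  assumes "k < n" "fractional n y"
  shows "multilinear n (\<lambda>S. g S - g (S - {k})) y = y k * marginal n g k y"
  using multilinear_split[OF assms, where g = g]
  by (simp add: marginal_def multilinear_diff algebra_simps)

text \<open>Coordinates are switched from \<open>y\<close> to \<open>z\<close> one at a time. Each
  switch is exact because the extension is affine in a single coordinate; the price is that the
  derivatives are taken at hybrid points.\<close>

lemma multilinear_telescope:
  assumes "fractional n y" "fractional n z"
  shows "multilinear n g z - multilinear n g y =
    (\<Sum>k<n. (z k - y k) * marginal n g k (\<lambda>u. if u < k then z u else y u))"
proof -
  define h where "h k = (\<lambda>u. if u < k then z u else y u)" for k
  have upd: "h (Suc k) = (h k)(k := z k)" for k by (auto simp: h_def fun_eq_iff)
  have "multilinear n g (h (Suc k)) - multilinear n g (h k) = (z k - y k) * marginal n g k (h k)"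
    if "k < n" for k
    unfolding upd using that assms multilinear_upd_diff[of k n "z k" "h k" g] by (auto simp: h_def)
  then have "(\<Sum>k<n. multilinear n g (h (Suc k)) - multilinear n g (h k)) =
      (\<Sum>k<n. (z k - y k) * marginal n g k (h k))" by simp
  moreover have "multilinear n g (h n) = multilinear n g z"
    by (rule multilinear_cong) (auto simp: h_def)
  moreover have "multilinear n g (h 0) = multilinear n g y"
    by (rule multilinear_cong) (auto simp: h_def)
  ultimately have "multilinear n g z - multilinear n g y = (\<Sum>k<n. (z k - y k) * marginal n g k (h k))"
    using sum_lessThan_telescope[of "\<lambda>k. multilinear n g (h k)" n] by simp
  then show ?thesis by (simp add: h_def)
qed

lemma multilinear_lipschitz:
  assumes "fractional n y" "fractional n z"
    and "\<And>S. S \<subseteq> {..<n} \<Longrightarrow> \<bar>g S\<bar> \<le> M"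
  shows "\<bar>multilinear n g z - multilinear n g y\<bar> \<le> 2 * M * (\<Sum>k<n. \<bar>z k - y k\<bar>)"
proof -
  have "\<bar>marginal n g k w\<bar> \<le> 2 * M" if "k < n" for k w
  proof -
    have "\<bar>g (insert k S) - g (S - {k})\<bar> \<le> 2 * M" if "S \<subseteq> {..<n}" for S
      using assms(3)[of "insert k S"] assms(3)[of "S - {k}"] that \<open>k < n\<close> by fastforce
    then show ?thesis
      unfolding marginal_def by (rule multilinear_abs_le)
  qed
  then have "\<bar>multilinear n g z - multilinear n g y\<bar> \<le> (\<Sum>k<n. \<bar>z k - y k\<bar> * (2 * M))"
    unfolding multilinear_telescope[OF assms(1,2)]
    by (intro order.trans[OF sum_abs] sum_mono) (auto simp: abs_mult intro!: mult_left_mono)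
  then show ?thesis by (simp add: sum_distrib_left mult_ac)
qed

text \<open>In the telescoping sum each hybrid point is within \<open>d\<close> of \<open>y\<close>
  in every coordinate, so by the Lipschitz bound each derivative differs from the one at
  \<open>y\<close> by at most \<open>2 * M * (n * d)\<close>. Multiplying by the displacement
  \<open>d\<close> and summing over \<open>n\<close> coordinates gives the error.\<close>

lemma multilinear_first_order:
  assumes y: "fractional n y" and z: "fractional n z"
    and g: "\<And>S. S \<subseteq> {..<n} \<Longrightarrow> 0 \<le> g S \<and> g S \<le> M"
    and d: "\<And>u. u < n \<Longrightarrow> \<bar>z u - y u\<bar> \<le> d"
  shows "multilinear n g y + (\<Sum>k<n. (z k - y k) * marginal n g k y) - 2 * M * (real n * d)\<^sup>2
    \<le> multilinear n g z"
proof -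
  define h where "h k = (\<lambda>u. if u < k then z u else y u)" for k
  have M: "0 \<le> M" using g[of "{}"] by auto
  have *: "(z k - y k) * marginal n g k y - d * (2 * M * (n * d)) \<le> (z k - y k) * marginal n g k (h k)"
    if k: "k < n" for k
  proof -
    have d0: "0 \<le> d" using d[OF k] by linarith
    have "\<bar>g (insert k S) - g (S - {k})\<bar> \<le> M" if "S \<subseteq> {..<n}" for S
      using g[of "insert k S"] g[of "S - {k}"] that k by fastforce
    then have "\<bar>marginal n g k (h k) - marginal n g k y\<bar> \<le> 2 * M * (\<Sum>j<n. \<bar>h k j - y j\<bar>)"
      unfolding marginal_def by (intro multilinear_lipschitz) (use y z in \<open>auto simp: h_def\<close>)
    also have "(\<Sum>j<n. \<bar>h k j - y j\<bar>) \<le> (\<Sum>j<n. d)"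
      using d d0 by (intro sum_mono) (auto simp: h_def)
    finally have "\<bar>marginal n g k (h k) - marginal n g k y\<bar> \<le> 2 * M * (n * d)"
      using M by (simp add: mult_left_mono)
    then have "\<bar>(z k - y k) * (marginal n g k (h k) - marginal n g k y)\<bar> \<le> d * (2 * M * (n * d))"
      unfolding abs_mult using d[OF k] d0 by (intro mult_mono) auto
    then show ?thesis by (simp add: algebra_simps abs_le_iff)
  qed
  have "(\<Sum>k<n. (z k - y k) * marginal n g k y - d * (2 * M * (n * d)))
      \<le> (\<Sum>k<n. (z k - y k) * marginal n g k (h k))"
    using * by (intro sum_mono) auto
  moreover have "(\<Sum>k<n. d * (2 * M * (n * d))) = 2 * M * (real n * d)\<^sup>2"
    by (simp add: power2_eq_square)
  ultimately show ?thesis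
    using multilinear_telescope[OF y z, where g = g]
    by (simp only: sum_subtractf flip: h_def)
qed

text \<open>The random set almost surely lies in \<open>A\<close>. This allows \<open>f\<close> to
  be replaced by its restriction to the admissible elements, where it is bounded in terms of the
  optimum.\<close>

lemma multilinear_restrict_support:
  assumes "fractional n y" "\<And>u. u < n \<Longrightarrow> u \<notin> A \<Longrightarrow> y u = 0"
  shows "multilinear n g y = multilinear n (\<lambda>S. g (S \<inter> A)) y"
  using assms
proof (induction n arbitrary: g)
  case (Suc n)
  have IH: "multilinear n h y = multilinear n (\<lambda>S. h (S \<inter> A)) y" for h
    using Suc.IH Suc.prems by auto
  have yn: "0 \<le> y n" "y n \<le> 1" using Suc.prems by auto
  show ?case
  proof (cases "n \<in> A")
    case True
    then have "insert n S \<inter> A = insert n (S \<inter> A)" for S by auto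
    then show ?thesis using yn IH[of g] IH[of "\<lambda>S. g (insert n S)"] by (simp add: multilinear_Suc)
  next
    case False
    then have "y n = 0" using Suc.prems by auto
    then show ?thesis using IH[of g] by (simp add: multilinear_Suc)
  qed
qed (simp add: multilinear_0)

lemma multilinear_integral:
  assumes "\<And>u. u < n \<Longrightarrow> y u \<in> {0, 1}"
  shows "multilinear n g y = g {u. u < n \<and> y u = 1}"
  using assms
proof (induction n arbitrary: g)
  case (Suc n)
  have eq: "{u. u < Suc n \<and> y u = 1} = (if y n = 1 then insert n {u. u < n \<and> y u = 1} else {u. u < n \<and> y u = 1})"
    by (auto simp: less_Suc_eq)
  have "y n = 0 \<or> y n = 1" using Suc.prems by auto
  moreover have "multilinear n h y = h {u. u < n \<and> y u = 1}" for h
    using Suc by auto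
  ultimately show ?case unfolding eq by (auto simp: multilinear_Suc)
qed (simp add: multilinear_0)

section \<open>The greedy step\<close>

lemma submodularD:
  assumes "submodular n f" "A \<subseteq> {..<n}" "B \<subseteq> {..<n}"
  shows "f (A \<union> B) + f (A \<inter> B) \<le> f A + f B"
  using assms unfolding submodular_def by auto

text \<open>Diminishing returns: inserting \<open>u\<close> after the rest of \<open>B\<close> gains
  at most as much as inserting it into \<open>S\<close> directly.\<close>

lemma submodular_insert_gains:
  assumes "submodular n f" "S \<subseteq> {..<n}" "finite B" "B \<subseteq> {..<n}"
  shows "f (S \<union> B) - f S \<le> (\<Sum>u\<in>B. f (insert u S) - f S)"
  using assms(3,4)
proof (induction B)
  case (insert u B)
  have "f (insert u (S \<union> B)) - f (S \<union> B) \<le> f (insert u S) - f S"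
  proof (cases "u \<in> S")
    case False
    then have "insert u S \<union> (S \<union> B) = insert u (S \<union> B)" "insert u S \<inter> (S \<union> B) = S"
      using insert.hyps by auto
    then show ?thesis
      using submodularD[OF assms(1), of "insert u S" "S \<union> B"] assms(2) insert.prems by auto
  qed (simp add: insert_absorb)
  then show ?case using insert by simp
qed simp

text \<open>The dual form of diminishing returns: taking \<open>u\<close> out of the smaller set
  \<open>S - B\<close> loses at least as much as taking it out of \<open>S\<close>.\<close>

lemma submodular_remove_losses:
  assumes "submodular n f" "S \<subseteq> {..<n}" "finite B"
  shows "(\<Sum>u\<in>B. f S - f (S - {u})) \<le> f S - f (S - B)"
  using assms(3)
proof (induction B)
  case (insert u B)
  have "f S - f (S - {u}) \<le> f (S - B) - f (S - insert u B)"
  proof (cases "u \<in> S")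
    case True
    have eq: "(S - B) \<union> (S - {u}) = S" "(S - B) \<inter> (S - {u}) = S - insert u B"
      using insert.hyps(2) by blast+
    have "S - B \<subseteq> {..<n}" "S - {u} \<subseteq> {..<n}" using assms(2) by blast+
    then show ?thesis
      using submodularD[OF assms(1), of "S - B" "S - {u}"] unfolding eq by linarith
  qed simp
  then show ?case using insert by simp
qed simp

text \<open>By symmetry \<open>S - B\<close> has the same value as its complement, the union of
  \<open>B\<close> with the complement of \<open>S\<close>. That set and \<open>S \<union> B\<close>
  intersect in \<open>B\<close> and together cover the ground set, whose value is
  non-negative.\<close>

lemma submodular_symmetric_union_diff:
  assumes "nonnegative n f" "symmetric n f" "submodular n f" "S \<subseteq> {..<n}" "B \<subseteq> {..<n}"
  shows "f B \<le> f (S \<union> B) + f (S - B)"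
proof -
  have "f (S - B) = f (({..<n} - S) \<union> B)"
  proof -
    have "{..<n} - (S - B) = ({..<n} - S) \<union> B" using assms(5) by auto
    then show ?thesis using assms(2,4) unfolding symmetric_def by (metis Diff_subset order_trans)
  qed
  moreover have "(S \<union> B) \<union> (({..<n} - S) \<union> B) = {..<n}" "(S \<union> B) \<inter> (({..<n} - S) \<union> B) = B"
    using assms(4,5) by auto
  moreover have "0 \<le> f {..<n}" using assms(1) by (auto simp: nonnegative_def)
  ultimately show ?thesis
    using submodularD[OF assms(3), of "S \<union> B" "({..<n} - S) \<union> B"] assms(4,5) by auto
qed

text \<open>A non-negative submodular function is subadditive on disjoint sets, so bounds on
  singletons add up. Taken with the optimum as \<open>V\<close>, this expresses sampling and
  discretization errors relative to the optimum.\<close>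

lemma submodular_le_card:
  assumes "nonnegative n f" "submodular n f" "S \<subseteq> {..<n}" "n \<ge> 1" "f {} \<le> V"
    and "\<And>u. u \<in> S \<Longrightarrow> f {u} \<le> V"
  shows "f S \<le> real n * V"
proof (cases "S = {}")
  case True
  have "0 \<le> V" using assms(1,5) unfolding nonnegative_def by force
  then have "1 * V \<le> real n * V" using assms(4) by (intro mult_right_mono) auto
  then show ?thesis using True assms(5) by simp
next
  case False
  have fin: "finite S" using assms(3) finite_subset by auto
  have "f S \<le> real (card S) * V"
    using fin False assms(3,6)
  proof (induction S rule: finite_ne_induct)
    case (insert u S)
    have "0 \<le> f ({u} \<inter> S)" using insert.prems insert.hyps assms(1) by (auto simp: nonnegative_def)
    then have "f (insert u S) \<le> f {u} + f S"
      using submodularD[OF assms(2), of "{u}" S] insert.prems by auto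
    moreover have "f {u} \<le> V" "f S \<le> real (card S) * V" using insert by auto
    ultimately show ?case using insert.hyps by (simp add: algebra_simps)
  qed simp
  moreover have "0 \<le> V" using assms(1,5) unfolding nonnegative_def by force
  moreover have "card S \<le> n" using card_mono[OF _ assms(3)] by simp
  ultimately show ?thesis by (meson mult_right_mono of_nat_le_iff order_trans)
qed

text \<open>
  The update \<open>y \<mapsto> (y + d x) / (1 + d x)\<close> replaces the usual \<open>y + d x (1 - y)\<close>: it stays in
  \<open>[0, 1]\<close> for every step size, and it multiplies \<open>1 - y\<close> by at least \<open>exp (- d x)\<close>, so
  the containment in the polytope suffers no discretization error.
\<close>

definition greedy_step :: "real \<Rightarrow> (nat \<Rightarrow> real) \<Rightarrow> (nat \<Rightarrow> real) \<Rightarrow> (nat \<Rightarrow> real) \<Rightarrow> nat \<Rightarrow> real" where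
  "greedy_step d e x y u =
     (if 0 \<le> e u then (y u + d * x u) / (1 + d * x u) else y u / (1 + d))"

lemma greedy_step_bounds:
  assumes "0 \<le> d" "0 \<le> x u" "x u \<le> 1" "0 \<le> y u" "y u \<le> 1"
  shows "0 \<le> greedy_step d e x y u" "greedy_step d e x y u \<le> 1"
    "\<bar>greedy_step d e x y u - y u\<bar> \<le> d"
    "1 - greedy_step d e x y u \<ge> (1 - y u) * exp (- d * x u)"
    "\<bar>greedy_step d e x y u - y u - d * (if 0 \<le> e u then (1 - y u) * x u else - y u)\<bar> \<le> d\<^sup>2"
proof -
  \<comment> \<open>\<open>c\<close> is the length of the ideal linear step and \<open>b\<close> the
    excess of the denominator over 1; the actual step has length \<open>c / (1 + b)\<close>, which
    differs from \<open>c\<close> by at most \<open>c * b\<close>.\<close>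
  define b where "b = (if 0 \<le> e u then d * x u else d)"
  define c where "c = (if 0 \<le> e u then d * x u * (1 - y u) else d * y u)"
  have dx: "0 \<le> d * x u" "d * x u \<le> d" using assms by (auto simp: mult_left_le)
  have b: "0 \<le> b" "b \<le> d" using dx assms by (auto simp: b_def)
  have c: "0 \<le> c" "c \<le> d"
    using mult_left_le[of "1 - y u" "d * x u"] mult_left_le[of "y u" d] dx assms by (auto simp: c_def)
  have bp: "0 < 1 + b" using b by simp
  have inc: "(z + (k - 1)) / k - z = (k - 1) * (1 - z) / k"
    and dec: "z / k - z = - ((k - 1) * z / k)" and shrink: "z - z / k = z * (k - 1) / k"
    and keep: "1 - (z + (k - 1)) / k = (1 - z) / k" if "0 < k" for k z :: real
    using that by (auto simp: field_simps)
  have diff: "greedy_step d e x y u - y u = (if 0 \<le> e u then c / (1 + b) else - (c / (1 + b)))"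
    using inc[OF bp, of "y u"] dec[OF bp, of "y u"]
    by (cases "0 \<le> e u") (simp_all add: greedy_step_def b_def c_def)
  show "0 \<le> greedy_step d e x y u" "greedy_step d e x y u \<le> 1"
    using bp assms dx by (cases "0 \<le> e u"; simp add: greedy_step_def b_def)+
  have frac: "0 \<le> a / (1 + b)" "a / (1 + b) \<le> a" if "0 \<le> a" for a
    using that divide_left_mono[of 1 "1 + b" a] b by auto
  show "\<bar>greedy_step d e x y u - y u\<bar> \<le> d"
    unfolding diff using frac[OF c(1)] c(2) by (cases "0 \<le> e u") (auto simp: abs_le_iff simp del: abs_divide)
  show "1 - greedy_step d e x y u \<ge> (1 - y u) * exp (- d * x u)"
  proof (cases "0 \<le> e u")
    case True
    have "1 - greedy_step d e x y u = (1 - y u) / (1 + d * x u)"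
      using keep[OF bp, of "y u"] True by (simp add: greedy_step_def b_def)
    moreover have "exp (- d * x u) \<le> 1 / (1 + d * x u)"
      using exp_ge_add_one_self[of "d * x u"] dx by (simp add: exp_minus inverse_eq_divide frac_le)
    then have "(1 - y u) * exp (- d * x u) \<le> (1 - y u) * (1 / (1 + d * x u))"
      using assms by (intro mult_left_mono) auto
    ultimately show ?thesis by simp
  next
    case False
    have "(1 - y u) * exp (- d * x u) \<le> 1 - y u" using dx assms by (intro mult_left_le) auto
    moreover have "greedy_step d e x y u \<le> y u" using diff False frac[OF c(1)] by simp
    ultimately show ?thesis by linarith
  qed
  have "c - c / (1 + b) = c * b / (1 + b)" using shrink[OF bp] by simp
  moreover have "0 \<le> c * b / (1 + b)" "c * b / (1 + b) \<le> c * b" using frac[of "c * b"] b c by auto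
  moreover have "c * b \<le> d\<^sup>2" using b c assms by (auto simp: power2_eq_square intro: mult_mono)
  moreover have "greedy_step d e x y u - y u - d * (if 0 \<le> e u then (1 - y u) * x u else - y u) =
      (if 0 \<le> e u then c / (1 + b) - c else c - c / (1 + b))"
    unfolding diff by (simp add: c_def)
  ultimately show "\<bar>greedy_step d e x y u - y u - d * (if 0 \<le> e u then (1 - y u) * x u else - y u)\<bar> \<le> d\<^sup>2"
    by (cases "0 \<le> e u") (simp_all add: abs_le_iff del: abs_divide)
qed

text \<open>
  Submodularity charges inserting (removing) all of \<open>B\<close> to the gradient, and symmetry bounds
  \<open>f(S \<union> B) + f(S - B)\<close> from below; a gradient entry that is negative is already exploited by
  decreasing that coordinate.
\<close>

lemma greedy_direction_gain:
  assumes f: "nonnegative n f" "symmetric n f" "submodular n f"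
    and y: "fractional n y" "\<And>u. u < n \<Longrightarrow> u \<notin> A \<Longrightarrow> y u = 0"
    and AB: "A \<subseteq> {..<n}" "B \<subseteq> A"
    and h: "0 \<le> h" and e: "\<And>u. u \<in> A \<Longrightarrow> \<bar>e u - marginal n f u y\<bar> \<le> h"
    and x: "fractional n x" "(\<Sum>u\<in>B. (1 - y u) * e u) \<le> (\<Sum>u\<in>A. (1 - y u) * e u * x u)"
  shows "f B - 2 * multilinear n f y - 3 * real n * h
    \<le> (\<Sum>u\<in>A. marginal n f u y * (if 0 \<le> e u then (1 - y u) * x u else - y u))"
proof -
  define D where "D u = marginal n f u y" for u
  have fin: "finite A" "finite B" using AB finite_subset by (auto intro: finite_subset)
  have An: "u < n" if "u \<in> A" for u using that AB by auto
  have insert: "multilinear n (\<lambda>S. f (S \<union> B)) y - multilinear n f y \<le> (\<Sum>u\<in>B. (1 - y u) * D u)"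
  proof -
    have "multilinear n (\<lambda>S. f (S \<union> B) - f S) y \<le> multilinear n (\<lambda>S. \<Sum>u\<in>B. f (insert u S) - f S) y"
      using submodular_insert_gains[OF f(3)] fin AB by (intro multilinear_mono) auto
    also have "\<dots> = (\<Sum>u\<in>B. (1 - y u) * D u)"
      unfolding multilinear_sum D_def using AB An y by (intro sum.cong multilinear_insert_gain) auto
    finally show ?thesis by (simp add: multilinear_diff)
  qed
  have remove: "(\<Sum>u\<in>B. y u * D u) \<le> multilinear n f y - multilinear n (\<lambda>S. f (S - B)) y"
  proof -
    have "(\<Sum>u\<in>B. y u * D u) = multilinear n (\<lambda>S. \<Sum>u\<in>B. f S - f (S - {u})) y"
      unfolding multilinear_sum D_def using AB An y
      by (intro sum.cong multilinear_remove_loss[symmetric]) auto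
    also have "\<dots> \<le> multilinear n (\<lambda>S. f S - f (S - B)) y"
      using submodular_remove_losses[OF f(3)] fin AB by (intro multilinear_mono) auto
    finally show ?thesis by (simp add: multilinear_diff)
  qed
  \<comment> \<open>The bounding lemma asks for an upper bound too; the maximum over all subsets
    serves as one.\<close>
  have sym: "f B \<le> multilinear n (\<lambda>S. f (S \<union> B)) y + multilinear n (\<lambda>S. f (S - B)) y"
    unfolding multilinear_add[symmetric]
    by (rule multilinear_bounds(1)[where b = "Max ((\<lambda>S. f (S \<union> B) + f (S - B)) ` Pow {..<n})"])
       (use submodular_symmetric_union_diff[OF f] AB in auto)
  have "card A \<le> n" using card_mono[OF _ AB(1)] by simp
  then have card: "real (card A) * h \<le> real n * h"
    using h by (intro mult_right_mono) auto
  have cardB: "(\<Sum>u\<in>B. h) \<le> (\<Sum>u\<in>A. h)" by (rule sum_mono2) (use fin AB h in auto)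
  have De: "\<bar>e u - D u\<bar> \<le> h" if "u \<in> A" for u using e that by (simp add: D_def)
  have m01: "\<bar>c * (e u - D u)\<bar> \<le> h" if "u \<in> A" "0 \<le> c" "c \<le> 1" for u c
    using mult_mono[of "\<bar>c\<bar>" 1 "\<bar>e u - D u\<bar>" h] De[OF that(1)] that by (simp add: abs_mult)
  \<comment> \<open>Split by the sign of the estimate. Passing between \<open>e\<close> and the true
    derivative costs \<open>h\<close> per element twice in \<open>pos\<close> (over
    \<open>B\<close>, then over \<open>A\<close>) and once in \<open>neg\<close>, which adds up to
    the \<open>3 * real n * h\<close> of the claim.\<close>
  let ?pos = "\<lambda>u. if 0 \<le> e u then D u * ((1 - y u) * x u) else 0"
  let ?neg = "\<lambda>u. if 0 \<le> e u then 0 else - (y u * D u)"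
  have pos: "(\<Sum>u\<in>B. (1 - y u) * D u) \<le> (\<Sum>u\<in>A. ?pos u + 2 * h)"
  proof -
    have "(1 - y u) * D u \<le> (1 - y u) * e u + h" if "u \<in> B" for u
      using m01[of u "1 - y u"] that AB An y by (auto simp: algebra_simps abs_le_iff)
    then have "(\<Sum>u\<in>B. (1 - y u) * D u) \<le> (\<Sum>u\<in>B. (1 - y u) * e u + h)" by (intro sum_mono) auto
    also have "\<dots> \<le> (\<Sum>u\<in>A. (1 - y u) * e u * x u) + (\<Sum>u\<in>A. h)"
      using x(2) cardB by (simp add: sum.distrib)
    also have "\<dots> = (\<Sum>u\<in>A. (1 - y u) * e u * x u + h)" by (simp add: sum.distrib)
    also have "\<dots> \<le> (\<Sum>u\<in>A. ?pos u + 2 * h)"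
    proof (rule sum_mono)
      fix u assume u: "u \<in> A"
      have c: "0 \<le> (1 - y u) * x u" "(1 - y u) * x u \<le> 1"
        using An[OF u] y x by (auto simp: mult_le_one)
      show "(1 - y u) * e u * x u + h \<le> ?pos u + 2 * h"
      proof (cases "0 \<le> e u")
        case True
        then show ?thesis using m01[OF u c] by (auto simp: algebra_simps abs_le_iff)
      next
        case False
        then have "(1 - y u) * e u * x u \<le> 0"
          using mult_nonneg_nonpos[of "(1 - y u) * x u" "e u"] c by (simp add: mult_ac)
        then show ?thesis using False h by simp
      qed
    qed
    finally show ?thesis .
  qed
  have neg: "- (\<Sum>u\<in>B. y u * D u) \<le> (\<Sum>u\<in>A. ?neg u + h)"
  proof -
    have "- (\<Sum>u\<in>B. y u * D u) = (\<Sum>u\<in>A. if u \<in> B then - (y u * D u) else 0)"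
      using AB fin by (simp add: sum_negf sum.If_cases Int_absorb1)
    \<comment> \<open>Two mismatches occur, and each costs at most \<open>h\<close>: an element of
      \<open>B\<close> with a non-negative estimate has \<open>- (y u * D u) \<le> h\<close>, and
      one outside \<open>B\<close> with a negative estimate has
      \<open>y u * D u \<le> h\<close>.\<close>
    also have "\<dots> \<le> (\<Sum>u\<in>A. ?neg u + h)"
    proof (rule sum_mono)
      fix u assume u: "u \<in> A"
      have "\<bar>y u * e u - y u * D u\<bar> \<le> h" using m01[OF u, of "y u"] An[OF u] y by (auto simp: algebra_simps)
      moreover have "0 \<le> e u \<Longrightarrow> 0 \<le> y u * e u" "e u \<le> 0 \<Longrightarrow> y u * e u \<le> 0"
        using An[OF u] y by (auto simp: mult_nonneg_nonpos)
      ultimately show "(if u \<in> B then - (y u * D u) else 0) \<le> ?neg u + h"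
        using h by (cases "0 \<le> e u") (auto simp: abs_le_iff)
    qed
    finally show ?thesis .
  qed
  have "(\<Sum>u\<in>A. ?pos u + 2 * h) + (\<Sum>u\<in>A. ?neg u + h) =
      (\<Sum>u\<in>A. D u * (if 0 \<le> e u then (1 - y u) * x u else - y u)) + 3 * (real (card A) * h)"
  proof -
    have "(\<Sum>u\<in>A. ?pos u + 2 * h) + (\<Sum>u\<in>A. ?neg u + h) =
        (\<Sum>u\<in>A. D u * (if 0 \<le> e u then (1 - y u) * x u else - y u) + 3 * h)"
      unfolding sum.distrib[symmetric] by (intro sum.cong) (auto simp: algebra_simps)
    then show ?thesis by (simp add: sum.distrib)
  qed
  moreover have "3 * (real (card A) * h) \<le> 3 * real n * h"
    using card by simp
  ultimately show ?thesis using insert remove sym pos neg unfolding D_def by linarith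
qed


text \<open>The first-order gain of the direction, less three errors: inaccurate estimates, the
  deviation of the update from a linear step, and the Taylor remainder. The last two are both
  quadratic in \<open>d\<close> and share one term.\<close>

lemma greedy_step_gain:
  assumes f: "nonnegative n f" "symmetric n f" "submodular n f" and n: "n \<ge> 1"
    and y: "fractional n y" "\<And>u. u < n \<Longrightarrow> u \<notin> A \<Longrightarrow> y u = 0"
    and AB: "A \<subseteq> {..<n}" "B \<subseteq> A"
    and V: "f {} \<le> V" "\<And>u. u \<in> A \<Longrightarrow> f {u} \<le> V"
    and h: "0 \<le> h" and e: "\<And>u. u \<in> A \<Longrightarrow> \<bar>e u - marginal n f u y\<bar> \<le> h"
    and e': "\<And>u. u < n \<Longrightarrow> u \<notin> A \<Longrightarrow> e u < 0"
    and x: "fractional n x" "(\<Sum>u\<in>B. (1 - y u) * e u) \<le> (\<Sum>u\<in>A. (1 - y u) * e u * x u)"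
    and d: "0 \<le> d"
  shows "multilinear n f y + d * (f B - 2 * multilinear n f y)
      - (3 * real n * h * d + 3 * real n ^ 3 * d\<^sup>2 * V)
    \<le> multilinear n f (greedy_step d e x y)"
proof -
  define z where "z = greedy_step d e x y"
  \<comment> \<open>Values of \<open>f\<close> outside \<open>A\<close> are not controlled by
    \<open>V\<close>. Coordinates outside \<open>A\<close> start at 0 and have negative estimates,
    so they stay at 0 and \<open>f\<close> may be replaced by \<open>g\<close>, which is at most
    \<open>real n * V\<close> everywhere.\<close>
  define g where "g S = f (S \<inter> A)" for S
  define dir where "dir u = (if 0 \<le> e u then (1 - y u) * x u else - y u)" for u
  have V0: "0 \<le> V" using V(1) f(1) unfolding nonnegative_def by force
  have zb: "0 \<le> z u \<and> z u \<le> 1" "\<bar>z u - y u\<bar> \<le> d" "\<bar>z u - y u - d * dir u\<bar> \<le> d\<^sup>2" if "u < n" for u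
    using greedy_step_bounds[of d x u y e] that d x y unfolding z_def dir_def by auto
  have zA: "z u = 0" if "u < n" "u \<notin> A" for u
    using y(2)[OF that] e'[OF that] by (simp add: z_def greedy_step_def)
  have gy: "multilinear n f y = multilinear n g y" and gz: "multilinear n f z = multilinear n g z"
    unfolding g_def using multilinear_restrict_support[of n _ A f] y zb zA by auto
  have marg: "marginal n f u y = marginal n g u y" if "u \<in> A" for u
  proof -
    have "insert u S \<inter> A = insert u (S \<inter> A)" "(S - {u}) \<inter> A = S \<inter> A - {u}" for S using that by auto
    then show ?thesis
      using multilinear_restrict_support[OF y(1), of A "\<lambda>S. f (insert u S) - f (S - {u})"] y(2)
      unfolding marginal_def g_def by simp
  qed
  have g: "0 \<le> g S \<and> g S \<le> real n * V" for S
  proof -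
    have "S \<inter> A \<subseteq> {..<n}" using AB by auto
    then show ?thesis
      using submodular_le_card[OF f(1,3), of "S \<inter> A" V] f(1) n V unfolding g_def nonnegative_def by auto
  qed
  have margb: "\<bar>marginal n g u y\<bar> \<le> real n * V" for u
  proof -
    have "\<bar>g (insert u S) - g (S - {u})\<bar> \<le> real n * V" for S
      using g[of "insert u S"] g[of "S - {u}"] by (simp add: abs_le_iff)
    then show ?thesis
      unfolding marginal_def by (rule multilinear_abs_le)
  qed
  have fin: "finite A" using AB finite_subset by auto
  have sumA: "(\<Sum>k<n. (z k - y k) * marginal n g k y) = (\<Sum>k\<in>A. (z k - y k) * marginal n g k y)"
    by (rule sum.mono_neutral_right) (use AB zA y in auto)
  have "(\<Sum>k\<in>A. d * (marginal n g k y * dir k) - d\<^sup>2 * (real n * V)) \<le> (\<Sum>k\<in>A. (z k - y k) * marginal n g k y)"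
  proof (rule sum_mono)
    fix k assume "k \<in> A"
    then have "\<bar>z k - y k - d * dir k\<bar> * \<bar>marginal n g k y\<bar> \<le> d\<^sup>2 * (real n * V)"
      using zb(3) AB margb by (intro mult_mono) auto
    then have "\<bar>(z k - y k - d * dir k) * marginal n g k y\<bar> \<le> d\<^sup>2 * (real n * V)" by (simp add: abs_mult)
    then show "d * (marginal n g k y * dir k) - d\<^sup>2 * (real n * V) \<le> (z k - y k) * marginal n g k y"
      by (simp add: abs_le_iff algebra_simps)
  qed
  moreover have "(\<Sum>k\<in>A. d * (marginal n g k y * dir k) - d\<^sup>2 * (real n * V)) =
      d * (\<Sum>k\<in>A. marginal n f k y * dir k) - real (card A) * (d\<^sup>2 * (real n * V))"
    by (simp add: sum_subtractf sum_distrib_left marg)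
  moreover have "real (card A) * (d\<^sup>2 * (real n * V)) \<le> real n * (d\<^sup>2 * (real n * V))"
    using card_mono[OF _ AB(1)] V0 by (intro mult_right_mono) auto
  moreover have "real n * (d\<^sup>2 * (real n * V)) + 2 * (real n * V) * (real n * d)\<^sup>2 \<le> 3 * real n ^ 3 * d\<^sup>2 * V"
  proof -
    have "real n ^ 2 * (d\<^sup>2 * V) \<le> real n ^ 3 * (d\<^sup>2 * V)"
      using V0 n by (intro mult_right_mono power_increasing) auto
    moreover have "real n * (d\<^sup>2 * (real n * V)) = real n ^ 2 * (d\<^sup>2 * V)"
      "2 * (real n * V) * (real n * d)\<^sup>2 = 2 * (real n ^ 3 * (d\<^sup>2 * V))"
      "3 * real n ^ 3 * d\<^sup>2 * V = 3 * (real n ^ 3 * (d\<^sup>2 * V))"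
      by (simp_all add: power2_eq_square power3_eq_cube mult_ac)
    ultimately show ?thesis by linarith
  qed
  moreover have "d * (f B - 2 * multilinear n f y - 3 * real n * h) \<le> d * (\<Sum>k\<in>A. marginal n f k y * dir k)"
    unfolding dir_def using greedy_direction_gain[OF f y AB h e x] d by (intro mult_left_mono) auto
  moreover have "multilinear n g y + (\<Sum>k<n. (z k - y k) * marginal n g k y)
      - 2 * (real n * V) * (real n * d)\<^sup>2 \<le> multilinear n g z"
    by (rule multilinear_first_order) (use y zb g in auto)
  moreover have "d * (f B - 2 * multilinear n f y) - 3 * real n * h * d =
      d * (f B - 2 * multilinear n f y - 3 * real n * h)" by (simp add: right_diff_distrib mult_ac)
  ultimately show ?thesis
    unfolding z_def[symmetric] gy[symmetric] gz[symmetric] sumA by linarith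
qed

section \<open>Down-monotone polytopes and their density\<close>

lemma cube_memD:
  assumes "x \<in> cube n" "u < n"
  shows "0 \<le> x u" "x u \<le> 1"
  using PiE_mem[of x "{..<n}" "\<lambda>_. {0..1}" u] assms unfolding cube_def by simp_all

lemma down_monotoneD:
  assumes "down_monotone n P" "P \<subseteq> cube n" "y \<in> P" "x \<in> extensional {..<n}"
    and "\<And>u. u < n \<Longrightarrow> 0 \<le> x u \<and> x u \<le> y u"
  shows "x \<in> P"
proof -
  have "y \<in> cube n" using assms by auto
  then have "x \<in> cube n" using assms(4,5) by (force simp: cube_def PiE_def)
  then show ?thesis using assms unfolding down_monotone_def by blast
qed

lemma zero_mem_polytope:
  assumes "cube_polytope n P" "down_monotone n P"
  shows "(\<lambda>u\<in>{..<n}. 0) \<in> P"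
proof -
  have cube: "P \<subseteq> cube n" and "P \<noteq> {}" using assms(1) by (auto simp: cube_polytope_def)
  then obtain y where y: "y \<in> P" by auto
  show ?thesis
    by (rule down_monotoneD[OF assms(2) cube y]) (use cube_memD[OF subsetD[OF cube y]] in auto)
qed

text \<open>Replace negative coefficients by 0 and drop the constraints that become trivial.
  Down-monotonicity keeps the strengthened constraints valid, and boundedness guarantees that some
  constraint survives.\<close>

lemma nonneg_representation_exists:
  assumes "n \<ge> 1" "cube_polytope n P" "down_monotone n P"
  shows "\<exists>m a b. nonneg_representation n P m a b"
proof -
  obtain m :: nat and a b where P: "P = {x \<in> {..<n} \<rightarrow>\<^sub>E UNIV. \<forall>i<m. (\<Sum>u<n. a i u * x u) \<le> b i}"
    and ne: "P \<noteq> {}" and cube: "P \<subseteq> cube n"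
    using assms(2) unfolding cube_polytope_def by (elim conjE exE) (rule that)
  define pos where "pos i u = max 0 (a i u)" for i u
  have nonneg: "0 \<le> x u" if "x \<in> P" "u < n" for x u
    using that cube by (intro cube_memD[of x n u]) auto
  have keep: "(\<Sum>u<n. pos i u * x u) \<le> b i" if "x \<in> P" "i < m" for x i
  proof -
    \<comment> \<open>Zeroing the coordinates with negative coefficients stays inside
      \<open>P\<close> and turns the original constraint into the strengthened one.\<close>
    define z where "z = (\<lambda>u\<in>{..<n}. if 0 \<le> a i u then x u else 0)"
    have "z \<in> P"
      by (rule down_monotoneD[OF assms(3) cube that(1)]) (use nonneg[OF that(1)] in \<open>auto simp: z_def\<close>)
    moreover have "(\<Sum>u<n. a i u * z u) = (\<Sum>u<n. pos i u * x u)"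
      by (rule sum.cong) (auto simp: z_def pos_def max_def)
    ultimately show ?thesis using that(2) P by auto
  qed
  have P': "P = {x \<in> {..<n} \<rightarrow>\<^sub>E {0..}. \<forall>i<m. (\<Sum>u<n. pos i u * x u) \<le> b i}"
  proof (intro equalityI subsetI)
    fix x assume "x \<in> P"
    moreover from this have "x \<in> {..<n} \<rightarrow>\<^sub>E {0..}" using cube by (force simp: cube_def PiE_def Pi_def)
    ultimately show "x \<in> {x \<in> {..<n} \<rightarrow>\<^sub>E {0..}. \<forall>i<m. (\<Sum>u<n. pos i u * x u) \<le> b i}"
      using keep by auto
  next
    fix x assume x: "x \<in> {x \<in> {..<n} \<rightarrow>\<^sub>E {0..}. \<forall>i<m. (\<Sum>u<n. pos i u * x u) \<le> b i}"
    have "(\<Sum>u<n. a i u * x u) \<le> b i" if "i < m" for i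
    proof -
      have "(\<Sum>u<n. a i u * x u) \<le> (\<Sum>u<n. pos i u * x u)"
        using x by (intro sum_mono mult_right_mono) (auto simp: pos_def)
      then show ?thesis using x that by fastforce
    qed
    moreover have "x \<in> {..<n} \<rightarrow>\<^sub>E UNIV" using x by (simp add: PiE_def)
    ultimately show "x \<in> P" unfolding P by simp
  qed
  define J where "J = {i. i < m \<and> (\<exists>u<n. pos i u \<noteq> 0)}"
  have finJ: "finite J" by (simp add: J_def)
  obtain g where g: "bij_betw g {..<card J} J" using ex_bij_betw_nat_finite[OF finJ] by (auto simp: atLeast0LessThan)
  have gJ: "g i \<in> J" if "i < card J" for i using g that by (auto simp: bij_betw_def)
  have Jg: "\<exists>i<card J. j = g i" if "j \<in> J" for j using g that by (auto simp: bij_betw_def)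
  have trivial: "(\<Sum>u<n. pos i u * x u) \<le> b i" if "i < m" "i \<notin> J" for i x
  proof -
    obtain y where "y \<in> P" using ne by auto
    then have "(\<Sum>u<n. pos i u * y u) \<le> b i" using keep that by auto
    moreover have "(\<Sum>u<n. pos i u * z u) = 0" for z using that by (intro sum.neutral) (auto simp: J_def)
    ultimately show ?thesis by metis
  qed
  have "(\<forall>i<m. (\<Sum>u<n. pos i u * x u) \<le> b i) \<longleftrightarrow> (\<forall>i<card J. (\<Sum>u<n. pos (g i) u * x u) \<le> b (g i))" for x
  proof (intro iffI allI impI)
    fix i assume "\<forall>i<m. (\<Sum>u<n. pos i u * x u) \<le> b i" "i < card J"
    then show "(\<Sum>u<n. pos (g i) u * x u) \<le> b (g i)" using gJ[of i] by (auto simp: J_def)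
  next
    fix i assume "\<forall>i<card J. (\<Sum>u<n. pos (g i) u * x u) \<le> b (g i)" "i < m"
    then show "(\<Sum>u<n. pos i u * x u) \<le> b i" using trivial Jg by metis
  qed
  then have P'': "P = {x \<in> {..<n} \<rightarrow>\<^sub>E {0..}. \<forall>i<card J. (\<Sum>u<n. pos (g i) u * x u) \<le> b (g i)}"
    unfolding P' by auto
  have "card J \<noteq> 0"
  proof
    assume "card J = 0"
    \<comment> \<open>Without constraints the constant vector 2 would be feasible, although
      \<open>P\<close> lies in the unit cube.\<close>
    then have "(\<lambda>u\<in>{..<n}. 2) \<in> P" unfolding P'' by auto
    then have "(\<lambda>u\<in>{..<n}. 2 :: real) 0 \<le> 1"
      by (rule cube_memD(2)[OF subsetD[OF cube]]) (use assms(1) in simp)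
    then show False using assms(1) by simp
  qed
  moreover have "0 \<le> pos i u" for i u by (simp add: pos_def)
  moreover have "\<exists>u<n. pos (g i) u \<noteq> 0" if "i < card J" for i
    using gJ[OF that] unfolding J_def by simp
  ultimately have "nonneg_representation n P (card J) (\<lambda>i. pos (g i)) (\<lambda>i. b (g i))"
    unfolding nonneg_representation_def by (simp add: P''[symmetric])
  then show ?thesis by blast
qed

text \<open>
  The ratio of a representation is the largest \<open>t\<close> for which the constant vector \<open>t\<close> lies in the
  polytope, so all representations have the same ratio and the maximum in the density exists.
\<close>

lemma nonneg_representation_constant:
  assumes "nonneg_representation n P m a b" "0 \<le> t"
  shows "(\<lambda>u\<in>{..<n}. t) \<in> P \<longleftrightarrow> t \<le> Min ((\<lambda>i. b i / (\<Sum>u<n. a i u)) ` {..<m})"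
proof -
  have m: "{..<m} \<noteq> {}" and P: "P = {x \<in> {..<n} \<rightarrow>\<^sub>E {0..}. \<forall>i<m. (\<Sum>u<n. a i u * x u) \<le> b i}"
    and a: "\<And>i u. i < m \<Longrightarrow> u < n \<Longrightarrow> 0 \<le> a i u" "\<And>i. i < m \<Longrightarrow> \<exists>u<n. a i u \<noteq> 0"
    using assms(1) unfolding nonneg_representation_def by (auto simp: lessThan_empty_iff)
  have pos: "0 < (\<Sum>u<n. a i u)" if i: "i < m" for i
  proof -
    obtain u where "u < n" "a i u \<noteq> 0" using a(2)[OF i] by auto
    then show ?thesis using a(1)[OF i] by (intro sum_pos2[of _ u]) (auto simp: less_le)
  qed
  have "(\<lambda>u\<in>{..<n}. t) \<in> P \<longleftrightarrow> (\<forall>i<m. (\<Sum>u<n. a i u * t) \<le> b i)"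
    unfolding P using assms(2) by auto
  also have "\<dots> \<longleftrightarrow> (\<forall>i<m. t \<le> b i / (\<Sum>u<n. a i u))"
    using pos by (simp add: pos_le_divide_eq sum_distrib_left mult.commute)
  also have "\<dots> \<longleftrightarrow> t \<le> Min ((\<lambda>i. b i / (\<Sum>u<n. a i u)) ` {..<m})"
    using m by (subst Min_ge_iff) auto
  finally show ?thesis .
qed

lemma polytope_density_eq:
  assumes "n \<ge> 1" "cube_polytope n P" "down_monotone n P" "nonneg_representation n P m a b"
  shows "polytope_density n P = Min ((\<lambda>i. b i / (\<Sum>u<n. a i u)) ` {..<m})"
    and "0 \<le> polytope_density n P" "polytope_density n P \<le> 1"
proof -
  let ?d = "\<lambda>m (a :: nat \<Rightarrow> nat \<Rightarrow> real) b. Min ((\<lambda>i. b i / (\<Sum>u<n. a i u)) ` {..<m})"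
  have cube: "P \<subseteq> cube n" using assms(2) by (auto simp: cube_polytope_def)
  have d0: "0 \<le> ?d m a b" if "nonneg_representation n P m a b" for m a b
    using nonneg_representation_constant[OF that, of 0] zero_mem_polytope[OF assms(2,3)] by simp
  \<comment> \<open>Each ratio, taken as a constant vector, lies in \<open>P\<close>, and is
    therefore at most the other ratio.\<close>
  have eq: "?d m' a' b' = ?d m a b" if r: "nonneg_representation n P m' a' b'" for m' a' b'
    using nonneg_representation_constant[OF r, of "?d m' a' b'"] nonneg_representation_constant[OF r, of "?d m a b"]
      nonneg_representation_constant[OF assms(4), of "?d m' a' b'"]
      nonneg_representation_constant[OF assms(4), of "?d m a b"] d0[OF r] d0[OF assms(4)] by (meson order_antisym order_refl)
  show D: "polytope_density n P = ?d m a b"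
    unfolding polytope_density_def
  proof (rule Greatest_equality)
    show "\<exists>m' a' b'. nonneg_representation n P m' a' b' \<and> ?d m a b = ?d m' a' b'"
      by (intro exI conjI) (rule assms(4), rule refl)
  next
    fix z assume "\<exists>m' a' b'. nonneg_representation n P m' a' b' \<and> z = ?d m' a' b'"
    then show "z \<le> ?d m a b" using eq by (elim exE conjE) simp
  qed
  show "0 \<le> polytope_density n P" using d0[OF assms(4)] by (simp add: D)
  have "(\<lambda>u\<in>{..<n}. ?d m a b) \<in> P" using nonneg_representation_constant[OF assms(4) d0[OF assms(4)]] by simp
  then have "(\<lambda>u\<in>{..<n}. ?d m a b) 0 \<le> 1"
    by (rule cube_memD(2)[OF subsetD[OF cube]]) (use assms(1) in simp)
  then show "polytope_density n P \<le> 1" using assms(1) by (simp add: D)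
qed

text \<open>The function \<open>1 - exp (- T * z)\<close> is concave in \<open>z\<close> and
  vanishes at 0, so once it is below the diagonal at \<open>d\<close> it stays below for larger
  \<open>z\<close>. This carries the inequality from the density to every constraint, whose ratio is
  at least the density.\<close>

lemma one_minus_exp_le_scaled:
  fixes T d z :: real
  assumes "0 < d" "d \<le> z" "1 - exp (- T * d) \<le> d"
  shows "1 - exp (- T * z) \<le> z"
proof -
  define c where "c = d / z"
  have z: "0 < z" using assms by linarith
  have c: "0 \<le> c" "c \<le> 1" "c * z = d" using assms z by (auto simp: c_def)
  have "exp ((1 - c) * 0 + c * (- T * z)) \<le> (1 - c) * exp 0 + c * exp (- T * z)"
    using convex_onD[OF exp_convex, of c 0 "- T * z"] c by simp
  then have "exp (- T * d) \<le> 1 - c + c * exp (- T * z)" using c(3) by (simp add: mult_ac)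
  then have "c * (1 - exp (- T * z)) \<le> c * z" using assms(3) c(3) by (simp add: algebra_simps)
  moreover have "0 < c" using assms z by (simp add: c_def)
  ultimately show ?thesis by simp
qed

text \<open>
  Concavity of \<open>1 - exp (- c)\<close> (Jensen) reduces each constraint to the case of equal coordinates.
\<close>

lemma exp_average_mem:
  assumes n: "n \<ge> 1" and P: "cube_polytope n P" "down_monotone n P"
    and T: "0 \<le> T" "T \<le> T_bound n P"
    and c: "\<And>u. u < n \<Longrightarrow> 0 \<le> c u" "(\<lambda>u\<in>{..<n}. c u / T) \<in> P"
    and x: "x \<in> extensional {..<n}" "\<And>u. u < n \<Longrightarrow> 0 \<le> x u \<and> x u \<le> 1 - exp (- c u)"
    and T0: "T = 0 \<Longrightarrow> \<forall>u<n. c u = 0"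
  shows "x \<in> P"
proof -
  obtain m a b where r: "nonneg_representation n P m a b"
    using nonneg_representation_exists[OF n P] by blast
  have Pr: "P = {x \<in> {..<n} \<rightarrow>\<^sub>E {0..}. \<forall>i<m. (\<Sum>u<n. a i u * x u) \<le> b i}"
    and a: "\<And>i u. i < m \<Longrightarrow> u < n \<Longrightarrow> 0 \<le> a i u" "\<And>i. i < m \<Longrightarrow> \<exists>u<n. a i u \<noteq> 0"
    using r unfolding nonneg_representation_def by auto
  define d where "d = polytope_density n P"
  have d: "0 \<le> d" "d \<le> 1" using polytope_density_eq(2,3)[OF n P r] by (auto simp: d_def)
  show ?thesis
  proof (cases "T = 0")
    case True
    \<comment> \<open>Both sides are the zero vector: all \<open>c u\<close> vanish, which forces
      \<open>x u = 0\<close>.\<close>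
    have "x = (\<lambda>u\<in>{..<n}. c u / T)"
      using x T0[OF True] True by (intro ext) (force simp: extensional_def restrict_def)
    then show ?thesis using c by simp
  next
    case False
    then have T_pos: "0 < T" using T by simp
    \<comment> \<open>For \<open>d = 0\<close> the division in \<open>T_bound\<close> yields 0,
      contradicting \<open>0 < T\<close>.\<close>
    have d_pos: "0 < d"
      using d T_pos T(2) by (cases "d = 0") (auto simp: T_bound_def d_def)
    have "T * d \<le> - ln (1 - d + 1 / real n ^ 4)"
      using T(2) d_pos pos_le_divide_eq[of d T "- ln (1 - d + 1 / real n ^ 4)"]
      unfolding T_bound_def d_def[symmetric] by simp
    moreover have pos: "0 < 1 - d + 1 / real n ^ 4" using d n by (simp add: add_nonneg_pos)
    ultimately have "1 - d + 1 / real n ^ 4 \<le> exp (- T * d)"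
      by (subst ln_le_cancel_iff[symmetric]) auto
    moreover have "0 \<le> 1 / real n ^ 4" by simp
    ultimately have Td: "1 - exp (- T * d) \<le> d" by linarith
    have "(\<Sum>u<n. a i u * x u) \<le> b i" if i: "i < m" for i
    proof -
      define S where "S = (\<Sum>u<n. a i u)"
      obtain u where "u < n" "a i u \<noteq> 0" using a(2)[OF i] by auto
      then have S: "0 < S" unfolding S_def using a(1)[OF i] by (intro sum_pos2[of _ u]) (auto simp: less_le)
      have d_le: "d \<le> b i / S"
        using polytope_density_eq(1)[OF n P r] i by (auto simp: d_def S_def intro!: Min_le)
      have "(\<Sum>u<n. a i u * (c u / T)) \<le> b i" using c(2) i unfolding Pr by simp
      then have sum_c: "(\<Sum>u<n. a i u * c u) \<le> T * b i"
        using T_pos by (simp add: sum_divide_distrib[symmetric] pos_divide_le_eq mult.commute)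
      \<comment> \<open>Jensen's inequality with the normalized coefficients of the constraint as
        weights.\<close>
      have "exp (\<Sum>u<n. (a i u / S) *\<^sub>R (- c u)) \<le> (\<Sum>u<n. (a i u / S) * exp (- c u))"
        using S a(1)[OF i] n
        by (intro convex_on_sum[OF _ _ exp_convex]) (auto simp: S_def sum_divide_distrib[symmetric] lessThan_empty_iff)
      moreover have "(\<Sum>u<n. (a i u / S) *\<^sub>R (- c u)) = - (\<Sum>u<n. a i u * c u) / S"
        by (simp add: sum_negf sum_divide_distrib)
      moreover have "- T * (b i / S) \<le> - (\<Sum>u<n. a i u * c u) / S"
        using sum_c S by (simp add: divide_right_mono)
      ultimately have J: "exp (- T * (b i / S)) \<le> (\<Sum>u<n. (a i u / S) * exp (- c u))"
        by (smt (verit) exp_le_cancel_iff)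
      have "(\<Sum>u<n. a i u * x u) \<le> (\<Sum>u<n. a i u * (1 - exp (- c u)))"
        using x(2) a(1)[OF i] by (intro sum_mono mult_left_mono) auto
      also have "\<dots> = S * (1 - (\<Sum>u<n. (a i u / S) * exp (- c u)))"
        using S by (simp add: S_def right_diff_distrib sum_subtractf sum_divide_distrib[symmetric])
      also have "\<dots> \<le> S * (1 - exp (- T * (b i / S)))" using J S by (intro mult_left_mono) auto
      also have "\<dots> \<le> S * (b i / S)"
        using one_minus_exp_le_scaled[OF d_pos d_le Td] S by (intro mult_left_mono) auto
      finally show ?thesis using S by simp
    qed
    moreover have "x \<in> {..<n} \<rightarrow>\<^sub>E {0..}" using x by (simp add: PiE_def Pi_def)
    ultimately show ?thesis unfolding Pr by auto
  qed
qed

section \<open>Reasoning about randomized programs\<close>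

text \<open>
  A Hoare-style judgement: \<open>I\<close> holds surely, and the expected potential \<open>\<Phi>\<close> is at most \<open>b\<close>. Potentials
  that are indicators of failure give union bounds, squared deviations give Chebyshev bounds.
\<close>

definition ensures :: "state pmf \<Rightarrow> (state \<Rightarrow> bool) \<Rightarrow> (state \<Rightarrow> real) \<Rightarrow> real \<Rightarrow> bool" where
  "ensures M I \<Phi> b \<longleftrightarrow>
     finite (set_pmf M) \<and> (\<forall>s\<in>set_pmf M. I s) \<and> measure_pmf.expectation M \<Phi> \<le> b"

lemma ensures_return: "I s \<Longrightarrow> \<Phi> s \<le> b \<Longrightarrow> ensures (return_pmf s) I \<Phi> b"
  by (simp add: ensures_def)

lemma ensures_mono:
  assumes "ensures M I \<Phi> b" "\<And>s. I s \<Longrightarrow> J s" "\<And>s. I s \<Longrightarrow> \<Psi> s \<le> \<Phi> s" "b \<le> c"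
  shows "ensures M J \<Psi> c"
proof -
  have "measure_pmf.expectation M \<Psi> \<le> measure_pmf.expectation M \<Phi>"
    using assms by (intro expectation_pmf_mono) (auto simp: ensures_def)
  then show ?thesis using assms by (auto simp: ensures_def)
qed

lemma ensures_affine:
  assumes "ensures M I \<Phi> b" "0 \<le> c"
  shows "ensures M I (\<lambda>s. a + c * \<Phi> s) (a + c * b)"
  using assms by (auto simp: ensures_def integrable_measure_pmf_finite mult_left_mono)

text \<open>The intermediate potential bounds the expected final potential from each state, up to
  \<open>c\<close>; averaging over \<open>M\<close> adds the two bounds.\<close>

lemma ensures_bind:
  assumes "ensures M I \<Phi> b" "\<And>s. I s \<Longrightarrow> ensures (K s) J \<Psi> (\<Phi> s + c)"
  shows "ensures (bind_pmf M K) J \<Psi> (b + c)"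
proof -
  have fin: "finite (set_pmf M)" "\<And>s. s \<in> set_pmf M \<Longrightarrow> finite (set_pmf (K s))"
    using assms by (auto simp: ensures_def)
  have "measure_pmf.expectation (bind_pmf M K) \<Psi> =
      measure_pmf.expectation M (\<lambda>s. measure_pmf.expectation (K s) \<Psi>)"
    using fin by (rule expectation_bind_pmf)
  also have "\<dots> \<le> measure_pmf.expectation M (\<lambda>s. \<Phi> s + c)"
    using assms by (intro expectation_pmf_mono) (auto simp: ensures_def)
  also have "\<dots> \<le> b + c" using assms fin by (simp add: integrable_measure_pmf_finite ensures_def)
  finally show ?thesis using assms fin by (auto simp: ensures_def)
qed

lemma ensures_fold:
  assumes "I 0 s" "\<And>j s. j < N \<Longrightarrow> I j s \<Longrightarrow> ensures (K j s) (I (Suc j)) (\<Phi> (Suc j)) (\<Phi> j s + c)"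
  shows "ensures (fold (\<lambda>j M. bind_pmf M (K j)) [0..<N] (return_pmf s)) (I N) (\<Phi> N)
    (\<Phi> 0 s + real N * c)"
  using assms(2)
proof (induction N)
  case 0
  show ?case using assms(1) by (simp add: ensures_return)
next
  case (Suc N)
  have "ensures (bind_pmf (fold (\<lambda>j M. bind_pmf M (K j)) [0..<N] (return_pmf s)) (K N))
      (I (Suc N)) (\<Phi> (Suc N)) ((\<Phi> 0 s + real N * c) + c)"
    by (rule ensures_bind[where I = "I N" and \<Phi> = "\<Phi> N"]) (use Suc in auto)
  then show ?case by (simp add: algebra_simps)
qed

section \<open>State updates, loops and nested loops\<close>

lemma state_simps [simp]:
  "idx (tick s) = idx s" "arr (tick s) = arr s"
  "idx (set_idx v k s) = (idx s)(v := k)" "arr (set_idx v k s) = arr s"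
  "idx (set_cell r j z s) = idx s" "arr (set_cell r j z s) = (arr s)(r := (arr s r)(j := z))"
  "idx (write_vec n r x s) = idx s"
  "arr (write_vec n r x s) = (arr s)(r := (\<lambda>u. if u < n then x u else arr s r u))"
  "steps (tick s) = Suc (steps s)" "steps (set_idx v k s) = steps s"
  "steps (set_cell r j z s) = steps s" "steps (write_vec n r x s) = steps s"
  by (simp_all add: tick_def set_idx_def set_cell_def write_vec_def)

text \<open>\<open>s\<^sub>0\<close> stands for the entry state, which fixes the iteration count,
  under the binder of the intermediate states.\<close>

lemma ensures_For:
  assumes "I 0 (tick s)"
    and "\<And>j s. j < ival e s\<^sub>0 \<Longrightarrow> I j s \<Longrightarrow>
      ensures (run n f opt c (tick (set_idx v j s))) (I (Suc j)) (\<Phi> (Suc j)) (\<Phi> j s + b)"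
    and "ival e s = ival e s\<^sub>0" "N = ival e s\<^sub>0"
  shows "ensures (run n f opt (For v e c) s) (I N) (\<Phi> N) (\<Phi> 0 (tick s) + real N * b)"
  using ensures_fold[of I "tick s" "ival e s\<^sub>0" "\<lambda>j s. run n f opt c (tick (set_idx v j s))" \<Phi> b] assms
  by simp

text \<open>Nested loops reach \<open>n ^ k\<close> repetitions without multiplying indices. All
  levels can share loop variable 3, since the iteration counts are fixed on entry and come from
  index 0.\<close>

primrec rep :: "nat \<Rightarrow> prog \<Rightarrow> prog" where
  "rep 0 c = c"
| "rep (Suc k) c = For 3 (IVar 0) (rep k c)"

text \<open>Invariant and potential are indexed by the total number of executions of
  \<open>c\<close>, so one pair serves all nesting levels.\<close>

lemma ensures_rep:
  assumes step: "\<And>t s. I t s \<Longrightarrow> ensures (run n f opt c s) (I (Suc t)) (\<Phi> (Suc t)) (\<Phi> t s + b)"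
    and idx: "\<And>t s. I t s \<Longrightarrow> idx s 0 = m"
    and I: "\<And>t s. I t s \<Longrightarrow> I t (tick s)" "\<And>t s j. I t s \<Longrightarrow> I t (set_idx 3 j s)"
    and \<Phi>: "\<And>t s. \<Phi> t (tick s) = \<Phi> t s" "\<And>t s j. \<Phi> t (set_idx 3 j s) = \<Phi> t s"
  shows "I t s \<Longrightarrow> ensures (run n f opt (rep k c) s) (I (t + m ^ k)) (\<Phi> (t + m ^ k)) (\<Phi> t s + real m ^ k * b)"
proof (induction k arbitrary: t s)
  case 0
  then show ?case using step by simp
next
  case (Suc k)
  have "ensures (run n f opt (rep k c) (tick (set_idx 3 j s')))
      (I (t + Suc j * m ^ k)) (\<Phi> (t + Suc j * m ^ k)) (\<Phi> (t + j * m ^ k) s' + real m ^ k * b)"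
    if "I (t + j * m ^ k) s'" for j s'
    using Suc.IH[of "t + j * m ^ k" "tick (set_idx 3 j s')"] that by (simp add: I \<Phi> add_ac)
  then have "ensures (run n f opt (For 3 (IVar 0) (rep k c)) s) (I (t + m * m ^ k)) (\<Phi> (t + m * m ^ k))
      (\<Phi> (t + 0 * m ^ k) (tick s) + real m * (real m ^ k * b))"
    using Suc.prems idx[OF Suc.prems]
    by (intro ensures_For[where I = "\<lambda>j. I (t + j * m ^ k)" and \<Phi> = "\<lambda>j. \<Phi> (t + j * m ^ k)"
          and s\<^sub>0 = s]) (auto simp: I)
  then show ?case by (simp add: \<Phi> mult_ac)
qed

section \<open>Polynomial running time from the syntax of a program\<close>

primrec linear_loops :: "prog \<Rightarrow> bool" where
  "linear_loops (ISet v e) \<longleftrightarrow> v \<noteq> 0"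
| "linear_loops (RSet r e d) \<longleftrightarrow> True"
| "linear_loops (Flip r e p) \<longleftrightarrow> True"
| "linear_loops (Value r e q) \<longleftrightarrow> True"
| "linear_loops (Optimize r q) \<longleftrightarrow> True"
| "linear_loops (Seq c d) \<longleftrightarrow> linear_loops c \<and> linear_loops d"
| "linear_loops (IfLe d e c1 c2) \<longleftrightarrow> linear_loops c1 \<and> linear_loops c2"
| "linear_loops (For v e c) \<longleftrightarrow> v \<noteq> 0 \<and> e = IVar 0 \<and> linear_loops c"

lemma set_pmf_fold:
  assumes "I 0 s" "\<And>j s s'. I j s \<Longrightarrow> s' \<in> set_pmf (K j s) \<Longrightarrow> I (Suc j) s'"
  shows "\<forall>s' \<in> set_pmf (fold (\<lambda>j M. bind_pmf M (K j)) [0..<N] (return_pmf s)). I N s'"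
  using assms by (induction N) auto

text \<open>Index 0 is never overwritten and bounds every loop, so sequencing adds polynomials and a
  loop multiplies by the variable. The polynomial depends on the program alone, uniformly in the
  oracles and the input.\<close>

lemma steps_polynomial:
  assumes "linear_loops c"
  shows "\<exists>q :: nat poly. \<forall>n f opt s. \<forall>s' \<in> set_pmf (run n f opt c s).
    steps s' \<le> steps s + poly q (idx s 0) \<and> idx s' 0 = idx s 0"
  using assms
proof (induction c)
  case (Seq c d)
  then obtain q r where q: "\<And>n f opt s s'. s' \<in> set_pmf (run n f opt c s) \<Longrightarrow>
      steps s' \<le> steps s + poly q (idx s 0) \<and> idx s' 0 = idx s 0"
    and r: "\<And>n f opt s s'. s' \<in> set_pmf (run n f opt d s) \<Longrightarrow>
      steps s' \<le> steps s + poly r (idx s 0) \<and> idx s' 0 = idx s 0"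
    by (metis linear_loops.simps(6))
  show ?case by (rule exI[of _ "q + r"]) (auto dest!: q r)
next
  case (IfLe x y c d)
  then obtain q r where q: "\<And>n f opt s s'. s' \<in> set_pmf (run n f opt c s) \<Longrightarrow>
      steps s' \<le> steps s + poly q (idx s 0) \<and> idx s' 0 = idx s 0"
    and r: "\<And>n f opt s s'. s' \<in> set_pmf (run n f opt d s) \<Longrightarrow>
      steps s' \<le> steps s + poly r (idx s 0) \<and> idx s' 0 = idx s 0"
    by (metis linear_loops.simps(7))
  show ?case by (rule exI[of _ "1 + q + r"]) (auto dest!: q r)
next
  case (For v e c)
  then obtain q where q: "\<And>n f opt s s'. s' \<in> set_pmf (run n f opt c s) \<Longrightarrow>
      steps s' \<le> steps s + poly q (idx s 0) \<and> idx s' 0 = idx s 0"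
    by (metis linear_loops.simps(8))
  have *: "\<forall>s' \<in> set_pmf (fold (\<lambda>j M. bind_pmf M (\<lambda>s'. run n f opt c (tick (set_idx v j s')))) [0..<N]
      (return_pmf (tick s))).
      steps s' \<le> steps s + 1 + N * (poly q (idx s 0) + 1) \<and> idx s' 0 = idx s 0" for n f opt s N
    using For.prems
    by (intro set_pmf_fold[where I = "\<lambda>N s'. steps s' \<le> steps s + 1 + N * (poly q (idx s 0) + 1) \<and> idx s' 0 = idx s 0"])
       (auto dest!: q)
  show ?case
    \<comment> \<open>One step for entering the loop, and one for each iteration besides the
      body.\<close>
    by (rule exI[of _ "1 + [:0, 1:] * (q + 1)"]) (use * For.prems in fastforce)
qed (auto intro!: exI[of _ "1 :: nat poly"])

section \<open>The algorithm\<close>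

primrec npow :: "nat \<Rightarrow> rexp" where
  "npow 0 = RNum 1"
| "npow (Suc k) = RMul (RIdx (IVar 0)) (npow k)"

lemma rval_npow [simp]: "rval (npow k) s = real (idx s 0) ^ k"
  by (induction k) auto

text \<open>
  Array 1 holds the current point \<open>y\<close>, array 2 the random set, array 3 the weights of a single
  coordinate (zero between uses), array 4 the optimizer's answer, array 5 the gradient estimates
  (\<open>-1\<close> for elements whose singleton is infeasible), array 7 the weights for the optimizer; cell 0 of
  array 6 accumulates the samples. Index 1 is the current element.
\<close>

definition draw :: prog where
  "draw = For 2 (IVar 0) (Flip 2 (IVar 2) (RCell 1 (IVar 2)))"

text \<open>One unbiased sample of a partial derivative: the same random set is queried with the
  current element put in and with it taken out.\<close>

definition sample :: prog where
  "sample = Seq draw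
     (Seq (RSet 2 (IVar 1) (RNum 1)) (Seq (Value 6 (INum 1) 2)
     (Seq (RSet 2 (IVar 1) (RNum 0)) (Seq (Value 6 (INum 2) 2)
       (RSet 6 (INum 0) (RAdd (RCell 6 (INum 0)) (RSub (RCell 6 (INum 1)) (RCell 6 (INum 2)))))))))"

text \<open>The optimizer with weight 1 on the current element alone decides whether that coordinate
  can reach 1. The count of \<open>n ^ 12\<close> samples makes the failure probability small enough
  for a union bound over all elements and all steps.\<close>

definition estimate :: prog where
  "estimate = Seq (RSet 6 (INum 0) (RNum 0)) (Seq (rep 12 sample)
     (Seq (RSet 3 (IVar 1) (RNum 1)) (Seq (Optimize 4 3) (Seq (RSet 3 (IVar 1) (RNum 0))
     (Seq (IfLe (RNum 1) (RCell 4 (IVar 1))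
        (RSet 5 (IVar 1) (RDiv (RCell 6 (INum 0)) (npow 12)))
        (RSet 5 (IVar 1) (RNum (-1))))
       (RSet 7 (IVar 1) (RMul (RSub (RNum 1) (RCell 1 (IVar 1))) (RCell 5 (IVar 1)))))))))"

definition update :: prog where
  "update = (let d = RDiv (RCell 0 (INum 0)) (npow 4); dx = RMul d (RCell 4 (IVar 1)); y = RCell 1 (IVar 1) in
     IfLe (RNum 0) (RCell 5 (IVar 1))
       (RSet 1 (IVar 1) (RDiv (RAdd y dx) (RAdd (RNum 1) dx)))
       (RSet 1 (IVar 1) (RDiv y (RAdd (RNum 1) d))))"

definition step :: prog where
  "step = Seq (For 1 (IVar 0) estimate) (Seq (Optimize 4 7) (For 1 (IVar 0) update))"

section \<open>Distribution of the samples, accuracy of the estimates and one greedy step\<close>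

text \<open>The loop follows the recursion of \<open>random_set_Suc\<close>. After \<open>j\<close>
  flips only the cells below \<open>j\<close> are read off, so earlier contents of array 2 do no
  harm.\<close>

lemma draw_random_set:
  assumes "idx s 0 = n"
  shows "map_pmf (\<lambda>s'. {v. v < n \<and> arr s' 2 v = 1}) (run n f opt draw s) = random_set n (arr s 1)"
    and "finite (set_pmf (run n f opt draw s))"
    and "\<forall>s' \<in> set_pmf (run n f opt draw s).
      idx s' 0 = n \<and> idx s' 1 = idx s 1 \<and> (\<forall>r. r \<noteq> 2 \<longrightarrow> arr s' r = arr s r)"
proof -
  define M where "M j = fold (\<lambda>j M. bind_pmf M (\<lambda>s'. run n f opt (Flip 2 (IVar 2) (RCell 1 (IVar 2)))
      (tick (set_idx 2 j s')))) [0..<j] (return_pmf (tick s))" for j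
  have run: "run n f opt draw s = M n" using assms by (simp add: draw_def M_def)
  have M0: "M 0 = return_pmf (tick s)" by (simp add: M_def)
  have MS: "M (Suc j) = bind_pmf (M j) (\<lambda>s'. map_pmf (\<lambda>c. tick (set_cell 2 j (of_bool c)
      (tick (set_idx 2 j s')))) (bernoulli_pmf (arr s' 1 j)))" for j
    by (simp add: M_def)
  have frame: "finite (set_pmf (M j)) \<and>
      (\<forall>s' \<in> set_pmf (M j). idx s' 0 = n \<and> idx s' 1 = idx s 1 \<and> (\<forall>r. r \<noteq> 2 \<longrightarrow> arr s' r = arr s r))" for j
    by (induction j) (auto simp: M0 MS assms)
  have "map_pmf (\<lambda>s'. {v. v < j \<and> arr s' 2 v = 1}) (M j) = random_set j (arr s 1)" for j
  proof (induction j)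
    case 0
    then show ?case by (simp add: M0 random_set_0)
  next
    case (Suc j)
    let ?S = "\<lambda>s'. {v. v < j \<and> arr s' 2 v = 1}"
    have set_eq: "{v. v < Suc j \<and> (if v = j then of_bool c else arr s' 2 v) = (1 :: real)} =
        (if c then insert j (?S s') else ?S s')" for s' c
      by auto
    have "map_pmf (\<lambda>s'. {v. v < Suc j \<and> arr s' 2 v = 1}) (M (Suc j)) =
        bind_pmf (M j) (\<lambda>s'. map_pmf (\<lambda>c. if c then insert j (?S s') else ?S s')
          (bernoulli_pmf (arr s' 1 j)))"
      by (simp add: MS map_bind_pmf pmf.map_comp o_def set_eq fun_upd_apply)
    also have "\<dots> = bind_pmf (M j) (\<lambda>s'. map_pmf (\<lambda>c. if c then insert j (?S s') else ?S s')
          (bernoulli_pmf (arr s 1 j)))"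
      using frame[of j] by (intro bind_pmf_cong) auto
    also have "\<dots> = bind_pmf (map_pmf ?S (M j)) (\<lambda>S. map_pmf (\<lambda>c. if c then insert j S else S)
          (bernoulli_pmf (arr s 1 j)))"
      by (simp add: bind_map_pmf)
    finally show ?case unfolding Suc.IH random_set_Suc .
  qed
  then show "map_pmf (\<lambda>s'. {v. v < n \<and> arr s' 2 v = 1}) (run n f opt draw s) = random_set n (arr s 1)"
    by (simp add: run)
  show "finite (set_pmf (run n f opt draw s))"
    "\<forall>s' \<in> set_pmf (run n f opt draw s).
      idx s' 0 = n \<and> idx s' 1 = idx s 1 \<and> (\<forall>r. r \<noteq> 2 \<longrightarrow> arr s' r = arr s r)"
    using frame[of n] by (simp_all add: run)
qed

text \<open>The function \<open>\<phi>\<close> is left arbitrary so that the squared deviation of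
  the running sum can be inserted.\<close>

lemma ensures_sample:
  assumes "idx s 0 = n" "idx s 1 = u" "u < n"
  shows "ensures (run n f opt sample s)
    (\<lambda>s'. idx s' 0 = n \<and> idx s' 1 = u \<and> (\<forall>r. r \<noteq> 2 \<longrightarrow> r \<noteq> 6 \<longrightarrow> arr s' r = arr s r))
    (\<lambda>s'. \<phi> (arr s' 6 0))
    (multilinear n (\<lambda>S. \<phi> (arr s 6 0 + (f (insert u S) - f (S - {u})))) (arr s 1))"
proof -
  let ?S = "\<lambda>s'. {v. v < n \<and> arr s' 2 v = 1}"
  let ?I = "\<lambda>s'. idx s' 0 = n \<and> idx s' 1 = u \<and> (\<forall>r. r \<noteq> 2 \<longrightarrow> arr s' r = arr s r)"
  let ?g = "\<lambda>S. \<phi> (arr s 6 0 + (f (insert u S) - f (S - {u})))"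
  have "ensures (run n f opt draw s) ?I (\<lambda>s'. ?g (?S s')) (multilinear n ?g (arr s 1))"
  proof -
    have "measure_pmf.expectation (run n f opt draw s) (\<lambda>s'. ?g (?S s')) =
        measure_pmf.expectation (map_pmf ?S (run n f opt draw s)) ?g"
      by simp
    then show ?thesis
      using draw_random_set[OF assms(1), of f opt] assms(2) by (simp add: ensures_def multilinear_def)
  qed
  then show ?thesis
    unfolding sample_def run.simps(6)[where d = "Seq _ _" and c = draw]
    apply (rule ensures_bind[where c = 0, simplified])
    subgoal for s'
    proof -
      assume I: "?I s'"
      have "{v. v < n \<and> ((arr s' 2)(u := 1)) v = 1} = insert u (?S s')"
        "{v. v < n \<and> ((arr s' 2)(u := 0)) v = 1} = ?S s' - {u}" using assms(3) by auto
      then show ?thesis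
        using I assms by (simp add: bind_return_pmf ensures_return)
    qed
    done
qed

text \<open>Additivity of the variance: the fresh sample has mean
  \<open>marginal n f u (arr s 1)\<close>, so the cross term vanishes and each round adds at most
  the second moment \<open>M\<close>.\<close>

lemma ensures_samples:
  assumes "idx s 0 = n" "idx s 1 = u" "u < n" "arr s 6 0 = 0"
    and "multilinear n (\<lambda>S. (f (insert u S) - f (S - {u}))\<^sup>2) (arr s 1) \<le> M"
  shows "ensures (run n f opt (rep k sample) s)
    (\<lambda>s'. idx s' 0 = n \<and> idx s' 1 = u \<and> (\<forall>r. r \<noteq> 2 \<longrightarrow> r \<noteq> 6 \<longrightarrow> arr s' r = arr s r))
    (\<lambda>s'. (arr s' 6 0 - real n ^ k * marginal n f u (arr s 1))\<^sup>2) (real n ^ k * M)"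
proof -
  define \<mu> where "\<mu> = marginal n f u (arr s 1)"
  let ?h = "\<lambda>S. f (insert u S) - f (S - {u})"
  define I where "I t s' \<longleftrightarrow> idx s' 0 = n \<and> idx s' 1 = u \<and> (\<forall>r. r \<noteq> 2 \<longrightarrow> r \<noteq> 6 \<longrightarrow> arr s' r = arr s r)"
    for t :: nat and s' :: state
  define \<Phi> where "\<Phi> t s' = (arr s' 6 0 - real t * \<mu>)\<^sup>2" for t :: nat and s' :: state
  have "ensures (run n f opt sample s') (I (Suc t)) (\<Phi> (Suc t)) (\<Phi> t s' + M)" if "I t s'" for t s'
  proof (rule ensures_mono[OF ensures_sample[of s' n u f opt "\<lambda>a. (a - real (Suc t) * \<mu>)\<^sup>2"]])
    let ?X = "arr s' 6 0 - real t * \<mu>"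
    \<comment> \<open>Arranged as a polynomial in the new sample, so that only its mean and its
      second moment enter the expectation.\<close>
    have sq: "(arr s' 6 0 + ?h S - real (Suc t) * \<mu>)\<^sup>2 =
        (?X\<^sup>2 - 2 * ?X * \<mu> + \<mu>\<^sup>2) + (2 * ?X - 2 * \<mu>) * ?h S + (?h S)\<^sup>2" for S
      by (simp add: power2_eq_square algebra_simps)
    have "multilinear n (\<lambda>S. (arr s' 6 0 + ?h S - real (Suc t) * \<mu>)\<^sup>2) (arr s 1) =
        (?X\<^sup>2 - 2 * ?X * \<mu> + \<mu>\<^sup>2) + (2 * ?X - 2 * \<mu>) * \<mu> + multilinear n (\<lambda>S. (?h S)\<^sup>2) (arr s 1)"
      unfolding sq multilinear_add multilinear_cmult multilinear_const by (simp add: \<mu>_def marginal_def)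
    also have "\<dots> = ?X\<^sup>2 - \<mu>\<^sup>2 + multilinear n (\<lambda>S. (?h S)\<^sup>2) (arr s 1)"
      by (simp add: power2_eq_square algebra_simps)
    also have "\<dots> \<le> \<Phi> t s' + M" using assms(5) zero_le_power2[of \<mu>] unfolding \<Phi>_def by linarith
    finally show "multilinear n (\<lambda>S. (arr s' 6 0 + ?h S - real (Suc t) * \<mu>)\<^sup>2) (arr s' 1) \<le> \<Phi> t s' + M"
      using that by (simp add: I_def)
  qed (use that assms in \<open>auto simp: I_def \<Phi>_def\<close>)
  then have "ensures (run n f opt (rep k sample) s) (I (0 + n ^ k)) (\<Phi> (0 + n ^ k)) (\<Phi> 0 s + real n ^ k * M)"
    by (rule ensures_rep) (use assms in \<open>auto simp: I_def \<Phi>_def\<close>)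
  then show ?thesis using assms(4) by (simp add: I_def[abs_def] \<Phi>_def[abs_def] \<mu>_def)
qed

text \<open>
  The elements whose singleton lies in the polytope. Other elements occur in no integral solution,
  and since the values of \<open>f\<close> on them are not bounded by the optimum, they are never used.
\<close>

definition admissible :: "nat \<Rightarrow> ((nat \<Rightarrow> real) \<Rightarrow> (nat \<Rightarrow> real)) \<Rightarrow> nat set" where
  "admissible n opt = {u. u < n \<and> 1 \<le> opt (\<lambda>v\<in>{..<n}. of_bool (v = u)) u}"

definition estimated :: "nat \<Rightarrow> ((nat \<Rightarrow> real) \<Rightarrow> (nat \<Rightarrow> real)) \<Rightarrow> state \<Rightarrow> nat \<Rightarrow> state \<Rightarrow> bool" where
  "estimated n opt s j s' \<longleftrightarrow> idx s' 0 = n \<and> arr s' 0 = arr s 0 \<and> arr s' 1 = arr s 1 \<and>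
     (\<forall>v<n. arr s' 3 v = 0) \<and>
     (\<forall>v<j. arr s' 7 v = (1 - arr s 1 v) * arr s' 5 v \<and> (v \<notin> admissible n opt \<longrightarrow> arr s' 5 v = -1))"

definition inaccurate ::
    "nat \<Rightarrow> (nat set \<Rightarrow> real) \<Rightarrow> ((nat \<Rightarrow> real) \<Rightarrow> (nat \<Rightarrow> real)) \<Rightarrow> real \<Rightarrow> (nat \<Rightarrow> real) \<Rightarrow> nat \<Rightarrow> (nat \<Rightarrow> real) \<Rightarrow> bool" where
  "inaccurate n f opt h y j e \<longleftrightarrow> (\<exists>v<j. v \<in> admissible n opt \<and> h < \<bar>e v - marginal n f v y\<bar>)"

text \<open>Chebyshev's inequality bounds the indicator of a deviation above \<open>h\<close> by a
  multiple of the squared deviation. Adding the failure indicator of the earlier elements yields the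
  union bound.\<close>

lemma ensures_estimate:
  assumes s': "estimated n opt s j s'" "idx s' 1 = j" "j < n" and h: "0 < h"
    and M: "j \<in> admissible n opt \<Longrightarrow> multilinear n (\<lambda>S. (f (insert j S) - f (S - {j}))\<^sup>2) (arr s 1) \<le> M" "0 \<le> M"
  shows "ensures (run n f opt estimate s') (estimated n opt s (Suc j))
    (\<lambda>s''. of_bool (inaccurate n f opt h (arr s 1) (Suc j) (arr s'' 5)))
    (of_bool (inaccurate n f opt h (arr s 1) j (arr s' 5)) + M / (real n ^ 12 * h\<^sup>2))"
proof -
  define y where "y = arr s 1"
  define A where "A = admissible n opt"
  define \<mu> where "\<mu> = marginal n f j y"
  define m where "m = real n ^ 12"
  have m: "0 < m" using s'(3) by (simp add: m_def)
  define b :: real where "b = of_bool (inaccurate n f opt h y j (arr s' 5))"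
  define s1 where "s1 = tick (set_cell 6 0 0 s')"
  \<comment> \<open>Inadmissible elements have no moment bound in terms of \<open>M\<close>. There
    the exact moment is used for the sampling loop, and the weight \<open>c = 0\<close> removes the
    deviation from the potential, as the estimate is replaced by -1 anyway.\<close>
  define M' where "M' = (if j \<in> A then M else multilinear n (\<lambda>S. (f (insert j S) - f (S - {j}))\<^sup>2) y)"
  define c where "c = (if j \<in> A then 1 / (m * h)\<^sup>2 else 0)"
  let ?I = "\<lambda>s''. idx s'' 0 = n \<and> idx s'' 1 = j \<and> (\<forall>r. r \<noteq> 2 \<longrightarrow> r \<noteq> 6 \<longrightarrow> arr s'' r = arr s' r)"
  have y: "arr s' 1 = y" using s' by (simp add: estimated_def y_def)
  have "ensures (run n f opt (rep 12 sample) s1) ?I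
      (\<lambda>s''. (arr s'' 6 0 - m * \<mu>)\<^sup>2) (m * M')"
    using ensures_samples[of s1 n j f M' opt 12] s' M(1)
    by (auto simp: s1_def estimated_def y_def \<mu>_def m_def M'_def A_def)
  then have "ensures (run n f opt (rep 12 sample) s1) ?I
      (\<lambda>s''. b + c * (arr s'' 6 0 - m * \<mu>)\<^sup>2) (b + c * (m * M'))"
    by (rule ensures_affine) (simp add: c_def)
  moreover have "b + c * (m * M') \<le> b + M / (m * h\<^sup>2)"
    using m h M(2) by (auto simp: c_def M'_def power2_eq_square mult_ac)
  ultimately have samples: "ensures (run n f opt (rep 12 sample) s1) ?I
      (\<lambda>s''. b + c * (arr s'' 6 0 - m * \<mu>)\<^sup>2) (b + M / (m * h\<^sup>2))"
    by (simp add: ensures_def)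
  have "ensures (bind_pmf (run n f opt (rep 12 sample) s1) (run n f opt
     (Seq (RSet 3 (IVar 1) (RNum 1)) (Seq (Optimize 4 3) (Seq (RSet 3 (IVar 1) (RNum 0))
     (Seq (IfLe (RNum 1) (RCell 4 (IVar 1))
        (RSet 5 (IVar 1) (RDiv (RCell 6 (INum 0)) (npow 12)))
        (RSet 5 (IVar 1) (RNum (-1))))
       (RSet 7 (IVar 1) (RMul (RSub (RNum 1) (RCell 1 (IVar 1))) (RCell 5 (IVar 1))))))))))
    (estimated n opt s (Suc j))
    (\<lambda>s''. of_bool (inaccurate n f opt h y (Suc j) (arr s'' 5))) ((b + M / (m * h\<^sup>2)) + 0)"
  proof (rule ensures_bind[OF samples])
    fix s2 :: state assume s2: "?I s2"
    define e where "e = (if j \<in> A then arr s2 6 0 / m else -1)"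
    have query: "(\<lambda>u\<in>{..<n}. ((arr s2 3)(j := 1)) u) = (\<lambda>v\<in>{..<n}. of_bool (v = j))"
      using s' s2 by (auto simp: estimated_def restrict_def)
    have bad: "of_bool (inaccurate n f opt h y (Suc j) ((arr s2 5)(j := e))) \<le> b + c * (arr s2 6 0 - m * \<mu>)\<^sup>2"
    proof (cases "inaccurate n f opt h y j (arr s' 5)")
      case True
      then show ?thesis by (simp add: b_def c_def)
    next
      case False
      show ?thesis
      proof (cases "j \<in> A \<and> h < \<bar>e - \<mu>\<bar>")
        case True
        have "(m * h)\<^sup>2 \<le> (m * \<bar>e - \<mu>\<bar>)\<^sup>2"
          using True m h by (intro power_mono mult_left_mono) auto
        also have "\<dots> = (arr s2 6 0 - m * \<mu>)\<^sup>2"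
          using True m by (simp add: e_def power_mult_distrib flip: power_mult_distrib) (simp add: field_simps)
        finally have "1 \<le> c * (arr s2 6 0 - m * \<mu>)\<^sup>2"
          using True m h by (simp add: c_def)
        moreover have "of_bool (inaccurate n f opt h y (Suc j) ((arr s2 5)(j := e))) \<le> (1 :: real)" by simp
        moreover have "0 \<le> b" by (simp add: b_def)
        ultimately show ?thesis by linarith
      next
        case no: False
        then have "\<not> inaccurate n f opt h y (Suc j) ((arr s2 5)(j := e))"
          using False s2 by (auto simp: inaccurate_def less_Suc_eq A_def \<mu>_def)
        then show ?thesis by (simp add: b_def c_def)
      qed
    qed
    have est: "estimated n opt s (Suc j) (tick (set_cell 7 j ((1 - y j) * e) (tick (set_cell 5 j e
        (tick (tick (set_cell 3 j 0 (tick (write_vec n 4 x (tick (set_cell 3 j 1 s2)))))))))))" for x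
      using s' s2 by (auto simp: estimated_def less_Suc_eq e_def A_def y_def)
    have A_iff: "j \<in> A \<longleftrightarrow> 1 \<le> opt (\<lambda>v\<in>{..<n}. of_bool (v = j)) j"
      using s'(3) by (simp add: A_def admissible_def)
    show "ensures (run n f opt
     (Seq (RSet 3 (IVar 1) (RNum 1)) (Seq (Optimize 4 3) (Seq (RSet 3 (IVar 1) (RNum 0))
     (Seq (IfLe (RNum 1) (RCell 4 (IVar 1))
        (RSet 5 (IVar 1) (RDiv (RCell 6 (INum 0)) (npow 12)))
        (RSet 5 (IVar 1) (RNum (-1))))
       (RSet 7 (IVar 1) (RMul (RSub (RNum 1) (RCell 1 (IVar 1))) (RCell 5 (IVar 1)))))))) s2)
      (estimated n opt s (Suc j))
      (\<lambda>s''. of_bool (inaccurate n f opt h y (Suc j) (arr s'' 5))) (b + c * (arr s2 6 0 - m * \<mu>)\<^sup>2 + 0)"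
    proof (cases "j \<in> A")
      case True
      then show ?thesis
        using est bad A_iff s2 s'(3) y query
        by (auto simp: bind_return_pmf read_vec_def e_def m_def intro!: ensures_return)
    next
      case False
      then show ?thesis
        using est bad A_iff s2 s'(3) y query
        by (auto simp: bind_return_pmf read_vec_def e_def m_def intro!: ensures_return)
    qed
  qed
  then show ?thesis
    using s' by (simp add: estimate_def bind_return_pmf s1_def b_def y_def m_def)
qed

text \<open>Only what holds surely is recorded here, for whatever estimates \<open>e\<close> were
  drawn; their accuracy is a separate, probabilistic condition.\<close>

definition greedy_move ::
    "nat \<Rightarrow> ((nat \<Rightarrow> real) \<Rightarrow> (nat \<Rightarrow> real)) \<Rightarrow> real \<Rightarrow> (nat \<Rightarrow> real) \<Rightarrow> (nat \<Rightarrow> real) \<Rightarrow> (nat \<Rightarrow> real) \<Rightarrow> bool" where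
  "greedy_move n opt d y e z \<longleftrightarrow> (\<forall>v<n. v \<notin> admissible n opt \<longrightarrow> e v = -1) \<and>
     (\<forall>v<n. z v = greedy_step d e (opt (\<lambda>v\<in>{..<n}. (1 - y v) * e v)) y v)"

lemma ensures_update:
  assumes "idx s 0 = n"
  shows "ensures (run n f opt (For 1 (IVar 0) update) s)
    (\<lambda>s'. idx s' 0 = n \<and> (\<forall>r. r \<noteq> 1 \<longrightarrow> arr s' r = arr s r) \<and>
      (\<forall>v<n. arr s' 1 v = greedy_step (arr s 0 0 / real n ^ 4) (arr s 5) (arr s 4) (arr s 1) v))
    (\<lambda>_. 0) 0"
proof -
  define z where "z = greedy_step (arr s 0 0 / real n ^ 4) (arr s 5) (arr s 4) (arr s 1)"
  \<comment> \<open>Updating in place is sound because the new value of a coordinate reads no other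
    coordinate of the current point.\<close>
  define I where "I j s' \<longleftrightarrow> idx s' 0 = n \<and> (\<forall>r. r \<noteq> 1 \<longrightarrow> arr s' r = arr s r) \<and>
      (\<forall>v. arr s' 1 v = (if v < j then z v else arr s 1 v))" for j and s' :: state
  have "ensures (run n f opt update (tick (set_idx 1 j s'))) (I (Suc j)) (\<lambda>_. 0) (0 + 0)"
    if "I j s'" for j s'
  proof (cases "0 \<le> arr s 5 j")
    case True
    then have zj: "z j = (arr s 1 j + arr s 0 0 / real n ^ 4 * arr s 4 j) / (1 + arr s 0 0 / real n ^ 4 * arr s 4 j)"
      by (simp add: z_def greedy_step_def)
    show ?thesis
      using that True unfolding update_def Let_def
      by (auto simp: I_def zj less_Suc_eq intro!: ensures_return)
  next
    case False
    then have zj: "z j = arr s 1 j / (1 + arr s 0 0 / real n ^ 4)"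
      by (simp add: z_def greedy_step_def)
    show ?thesis
      using that False unfolding update_def Let_def
      by (auto simp: I_def zj less_Suc_eq intro!: ensures_return)
  qed
  then have "ensures (run n f opt (For 1 (IVar 0) update) s) (I n) (\<lambda>_. 0) (0 + real n * 0)"
    by (intro ensures_For[where I = I and \<Phi> = "\<lambda>_ _. 0" and s\<^sub>0 = s]) (use assms in \<open>auto simp: I_def\<close>)
  then show ?thesis
    by (rule ensures_mono) (auto simp: I_def z_def)
qed

lemma ensures_step:
  assumes s: "idx s 0 = n" "\<forall>v<n. arr s 3 v = 0" and h: "0 < h" and M0: "0 \<le> M"
    and M: "\<And>j. j \<in> admissible n opt \<Longrightarrow>
      multilinear n (\<lambda>S. (f (insert j S) - f (S - {j}))\<^sup>2) (arr s 1) \<le> M"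
  defines "move \<equiv> greedy_move n opt (arr s 0 0 / real n ^ 4) (arr s 1)"
  shows "ensures (run n f opt step s)
    (\<lambda>s'. idx s' 0 = n \<and> arr s' 0 = arr s 0 \<and> (\<forall>v<n. arr s' 3 v = 0) \<and> (\<exists>e. move e (arr s' 1)))
    (\<lambda>s'. of_bool (\<not> (\<exists>e. move e (arr s' 1) \<and> \<not> inaccurate n f opt h (arr s 1) n e)))
    (real n * (M / (real n ^ 12 * h\<^sup>2)))"
proof -
  let ?bad = "\<lambda>j s'. of_bool (inaccurate n f opt h (arr s 1) j (arr s' 5)) :: real"
  have "ensures (run n f opt (For 1 (IVar 0) estimate) s) (estimated n opt s n) (?bad n)
      (?bad 0 (tick s) + real n * (M / (real n ^ 12 * h\<^sup>2)))"
  proof (rule ensures_For[where I = "estimated n opt s" and \<Phi> = ?bad and s\<^sub>0 = s])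
    fix j s' assume "j < ival (IVar 0) s" "estimated n opt s j s'"
    then have "estimated n opt s j (tick (set_idx 1 j s'))" "idx (tick (set_idx 1 j s')) 1 = j" "j < n"
      using s by (auto simp: estimated_def)
    from ensures_estimate[OF this h M M0]
    show "ensures (run n f opt estimate (tick (set_idx 1 j s'))) (estimated n opt s (Suc j)) (?bad (Suc j))
        (?bad j s' + M / (real n ^ 12 * h\<^sup>2))" by simp
  qed (use s in \<open>auto simp: estimated_def\<close>)
  moreover have "?bad 0 (tick s) = 0" by (simp add: inaccurate_def)
  ultimately have "ensures (run n f opt (For 1 (IVar 0) estimate) s) (estimated n opt s n) (?bad n)
      (real n * (M / (real n ^ 12 * h\<^sup>2)))" by simp
  then have "ensures (run n f opt step s)
    (\<lambda>s'. idx s' 0 = n \<and> arr s' 0 = arr s 0 \<and> (\<forall>v<n. arr s' 3 v = 0) \<and> (\<exists>e. move e (arr s' 1)))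
    (\<lambda>s'. of_bool (\<not> (\<exists>e. move e (arr s' 1) \<and> \<not> inaccurate n f opt h (arr s 1) n e)))
    (real n * (M / (real n ^ 12 * h\<^sup>2)) + 0)"
    unfolding step_def run.simps(6)[of n f opt "For 1 (IVar 0) estimate"]
  proof (rule ensures_bind)
    fix s' assume s': "estimated n opt s n s'"
    define e where "e = arr s' 5"
    define x where "x = opt (\<lambda>v\<in>{..<n}. (1 - arr s 1 v) * e v)"
    define s1 where "s1 = tick (write_vec n 4 (opt (read_vec n 7 s')) s')"
    have "read_vec n 7 s' = (\<lambda>v\<in>{..<n}. (1 - arr s 1 v) * e v)"
      using s' by (auto simp: estimated_def read_vec_def e_def restrict_def)
    then have x: "arr s1 4 v = x v" if "v < n" for v using that by (simp add: s1_def x_def)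
    have s1: "idx s1 0 = n" "arr s1 0 = arr s 0" "arr s1 1 = arr s 1" "\<forall>v<n. arr s1 3 v = 0" "arr s1 5 = e"
      using s' by (auto simp: s1_def estimated_def e_def)
    have e: "e v = -1" if "v < n" "v \<notin> admissible n opt" for v
      using s' that by (auto simp: estimated_def e_def)
    let ?b = "?bad n s'"
    have "ensures (run n f opt (For 1 (IVar 0) update) s1)
       (\<lambda>s'. idx s' 0 = n \<and> (\<forall>r. r \<noteq> 1 \<longrightarrow> arr s' r = arr s1 r) \<and>
         (\<forall>v<n. arr s' 1 v = greedy_step (arr s1 0 0 / real n ^ 4) (arr s1 5) (arr s1 4) (arr s1 1) v))
       (\<lambda>_. ?b + 1 * 0) (?b + 1 * 0)"
      by (rule ensures_affine[OF ensures_update]) (use s1 in auto)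
    then have "ensures (run n f opt (For 1 (IVar 0) update) s1)
      (\<lambda>s'. idx s' 0 = n \<and> arr s' 0 = arr s 0 \<and> (\<forall>v<n. arr s' 3 v = 0) \<and> (\<exists>e. move e (arr s' 1)))
      (\<lambda>s'. of_bool (\<not> (\<exists>e. move e (arr s' 1) \<and> \<not> inaccurate n f opt h (arr s 1) n e))) (?b + 0)"
    proof (rule ensures_mono)
      fix s2 assume s2: "idx s2 0 = n \<and> (\<forall>r. r \<noteq> 1 \<longrightarrow> arr s2 r = arr s1 r) \<and>
         (\<forall>v<n. arr s2 1 v = greedy_step (arr s1 0 0 / real n ^ 4) (arr s1 5) (arr s1 4) (arr s1 1) v)"
      have mv: "move e (arr s2 1)"
        unfolding move_def greedy_move_def x_def[symmetric]
        using s2 s1 e x by (simp add: greedy_step_def)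
      then show "idx s2 0 = n \<and> arr s2 0 = arr s 0 \<and> (\<forall>v<n. arr s2 3 v = 0) \<and> (\<exists>e. move e (arr s2 1))"
        using s2 s1 by auto
      show "of_bool (\<not> (\<exists>e. move e (arr s2 1) \<and> \<not> inaccurate n f opt h (arr s 1) n e)) \<le> ?b + 1 * (0 :: real)"
        using mv by (auto simp: e_def)
    qed simp
    then show "ensures (run n f opt (Seq (Optimize 4 7) (For 1 (IVar 0) update)) s')
      (\<lambda>s'. idx s' 0 = n \<and> arr s' 0 = arr s 0 \<and> (\<forall>v<n. arr s' 3 v = 0) \<and> (\<exists>e. move e (arr s' 1)))
      (\<lambda>s'. of_bool (\<not> (\<exists>e. move e (arr s' 1) \<and> \<not> inaccurate n f opt h (arr s 1) n e))) (?b + 0)"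
      by (simp add: bind_return_pmf s1_def del: run.simps(8))
  qed
  then show ?thesis by simp
qed

section \<open>Analysis of the algorithm\<close>

lemma polytope_average_mem:
  assumes "cube_polytope n P" "\<And>i. i < N \<Longrightarrow> X i \<in> P" "0 < N"
  shows "(\<lambda>u\<in>{..<n}. (\<Sum>i<N. X i u) / real N) \<in> P"
proof -
  obtain m :: nat and a b where P: "P = {x \<in> {..<n} \<rightarrow>\<^sub>E UNIV. \<forall>i<m. (\<Sum>u<n. a i u * x u) \<le> b i}"
    using assms(1) unfolding cube_polytope_def by (elim conjE exE) (rule that)
  have "(\<Sum>u<n. a k u * ((\<Sum>i<N. X i u) / real N)) \<le> b k" if k: "k < m" for k
  proof -
    have "(\<Sum>u<n. a k u * ((\<Sum>i<N. X i u) / real N)) = (\<Sum>u<n. \<Sum>i<N. a k u * X i u) / real N"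
      by (simp add: sum_distrib_left sum_divide_distrib)
    also have "(\<Sum>u<n. \<Sum>i<N. a k u * X i u) = (\<Sum>i<N. \<Sum>u<n. a k u * X i u)" by (rule sum.swap)
    also have "\<dots> \<le> (\<Sum>i<N. b k)" using assms(2) k unfolding P by (intro sum_mono) auto
    finally show ?thesis using assms(3) by (simp add: divide_right_mono)
  qed
  then show ?thesis unfolding P by simp
qed

lemma linear_optimizerD:
  assumes "linear_optimizer n P opt"
  shows "opt w \<in> P" "y \<in> P \<Longrightarrow> (\<Sum>u<n. w u * y u) \<le> (\<Sum>u<n. w u * opt w u)"
  using assms unfolding linear_optimizer_def by auto

text \<open>With weight 1 on \<open>u\<close> alone, the optimizer maximizes coordinate
  \<open>u\<close>. If the maximum is 1, down-monotonicity shrinks the maximizer to the unit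
  vector.\<close>

lemma indicator_mem_iff_admissible:
  assumes "cube_polytope n P" "down_monotone n P" "linear_optimizer n P opt" "u < n"
  shows "(\<lambda>v\<in>{..<n}. of_bool (v = u)) \<in> P \<longleftrightarrow> u \<in> admissible n opt"
    and "y \<in> P \<Longrightarrow> y u = 1 \<Longrightarrow> u \<in> admissible n opt"
proof -
  have cube: "P \<subseteq> cube n" using assms(1) by (auto simp: cube_polytope_def)
  let ?w = "(\<lambda>v\<in>{..<n}. of_bool (v = u)) :: nat \<Rightarrow> real"
  have pick: "(\<Sum>v<n. ?w v * y v) = y u" for y
  proof -
    have "(\<Sum>v<n. ?w v * y v) = (\<Sum>v<n. if v = u then y v else 0)" by (rule sum.cong) auto
    then show ?thesis using assms(4) by simp
  qed
  show adm: "u \<in> admissible n opt" if "y \<in> P" "y u = 1" for y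
    using linear_optimizerD(2)[OF assms(3) that(1), of ?w] that(2) assms(4)
    unfolding pick by (simp add: admissible_def)
  show "?w \<in> P \<longleftrightarrow> u \<in> admissible n opt"
  proof
    assume "?w \<in> P"
    then show "u \<in> admissible n opt" by (rule adm) (use assms(4) in simp)
  next
    assume u: "u \<in> admissible n opt"
    have x: "opt ?w \<in> P" by (rule linear_optimizerD[OF assms(3)])
    show "?w \<in> P"
      by (rule down_monotoneD[OF assms(2) cube x])
         (use u cube_memD[OF subsetD[OF cube x]] in \<open>auto simp: admissible_def\<close>)
  qed
qed

text \<open>The empty set and the admissible singletons are themselves integral solutions, so their
  values are at most the optimum; an optimal set uses admissible elements only.\<close>

lemma integral_optimum:
  fixes f :: "nat set \<Rightarrow> real"
  assumes P: "cube_polytope n P" "down_monotone n P" and opt: "linear_optimizer n P opt"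
  defines "V \<equiv> Max (multilinear n f ` (P \<inter> ({..<n} \<rightarrow>\<^sub>E {0, 1})))"
  obtains z B where "z \<in> P" "\<And>u. u < n \<Longrightarrow> z u = of_bool (u \<in> B)" "B \<subseteq> admissible n opt" "f B = V"
    "f {} \<le> V" "\<And>u. u \<in> admissible n opt \<Longrightarrow> f {u} \<le> V"
proof -
  let ?Z = "P \<inter> ({..<n} \<rightarrow>\<^sub>E {0, 1 :: real})"
  have fin: "finite (multilinear n f ` ?Z)" by (auto intro!: finite_imageI finite_Int finite_PiE)
  have le: "f {u. u < n \<and> x u = 1} \<le> V" if "x \<in> ?Z" for x
  proof -
    have "x u \<in> {0, 1}" if "u < n" for u using \<open>x \<in> ?Z\<close> that PiE_mem[of x "{..<n}" "\<lambda>_. {0, 1}" u] by simp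
    then have "multilinear n f x = f {u. u < n \<and> x u = 1}" by (rule multilinear_integral)
    then show ?thesis using Max_ge[OF fin imageI[OF that]] by (simp add: V_def)
  qed
  have zero: "(\<lambda>u\<in>{..<n}. 0) \<in> ?Z" using zero_mem_polytope[OF P] by auto
  have "V \<in> multilinear n f ` ?Z" unfolding V_def by (rule Max_in[OF fin]) (use zero in blast)
  then obtain z where z: "z \<in> ?Z" and Vz: "V = multilinear n f z" by auto
  have z01: "z u \<in> {0, 1}" if "u < n" for u using z that PiE_mem[of z "{..<n}" "\<lambda>_. {0, 1}" u] by simp
  define B where "B = {u. u < n \<and> z u = 1}"
  show ?thesis
  proof (rule that[of z B])
    show "z \<in> P" using z by simp
    show "z u = of_bool (u \<in> B)" if "u < n" for u using z01[OF that] that by (auto simp: B_def)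
    show "B \<subseteq> admissible n opt"
      using indicator_mem_iff_admissible(2)[OF P opt] z by (auto simp: B_def)
    show "f B = V" unfolding Vz B_def by (rule multilinear_integral[symmetric]) (rule z01)
    have "{u. u < n \<and> (\<lambda>u\<in>{..<n}. 0 :: real) u = 1} = {}" by auto
    then show "f {} \<le> V" using le[OF zero] by (simp only:)
    show "f {u} \<le> V" if u: "u \<in> admissible n opt" for u
    proof -
      let ?w = "(\<lambda>v\<in>{..<n}. of_bool (v = u)) :: nat \<Rightarrow> real"
      have "u < n" using u by (simp add: admissible_def)
      then have "?w \<in> ?Z" using indicator_mem_iff_admissible(1)[OF P opt] u by auto
      moreover have "{v. v < n \<and> ?w v = 1} = {u}" using \<open>u < n\<close> by auto
      ultimately show ?thesis using le by metis
    qed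
  qed
qed

text \<open>The witness \<open>X\<close> collects the optimizer's answers so far. This invariant
  holds surely, so containment in the polytope does not rest on the accuracy of the
  estimates.\<close>

definition greedy_reachable :: "nat \<Rightarrow> (nat \<Rightarrow> real) set \<Rightarrow> nat set \<Rightarrow> real \<Rightarrow> nat \<Rightarrow> (nat \<Rightarrow> real) \<Rightarrow> bool" where
  "greedy_reachable n P A d t y \<longleftrightarrow> fractional n y \<and> (\<forall>u<n. u \<notin> A \<longrightarrow> y u = 0) \<and>
     (\<exists>X. (\<forall>i<t. X i \<in> P) \<and> (\<forall>u<n. y u \<le> 1 - exp (- (d * (\<Sum>i<t. X i u)))))"

lemma greedy_reachable_Suc:
  assumes y: "greedy_reachable n P (admissible n opt) d t y" and z: "greedy_move n opt d y e z"
    and P: "P \<subseteq> cube n" "linear_optimizer n P opt" and d: "0 \<le> d"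
  shows "greedy_reachable n P (admissible n opt) d (Suc t) z"
proof -
  define x where "x = opt (\<lambda>v\<in>{..<n}. (1 - y v) * e v)"
  have x: "x \<in> P" unfolding x_def by (rule linear_optimizerD[OF P(2)])
  have zx: "z v = greedy_step d e x y v" if "v < n" for v
    using z that by (simp add: greedy_move_def x_def)
  have yb: "fractional n y" and yA: "\<And>u. u < n \<Longrightarrow> u \<notin> admissible n opt \<Longrightarrow> y u = 0"
    using y by (auto simp: greedy_reachable_def)
  obtain X where X: "\<And>i. i < t \<Longrightarrow> X i \<in> P" "\<And>u. u < n \<Longrightarrow> y u \<le> 1 - exp (- (d * (\<Sum>i<t. X i u)))"
    using y by (auto simp: greedy_reachable_def)
  note xb = cube_memD[OF subsetD[OF P(1) x]]
  have step: "0 \<le> z u" "z u \<le> 1" "1 - z u \<ge> (1 - y u) * exp (- d * x u)" if "u < n" for u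
    using greedy_step_bounds[of d x u y e] d xb[OF that] yb that zx[OF that] by auto
  have "z u \<le> 1 - exp (- (d * (\<Sum>i<Suc t. (X(t := x)) i u)))" if u: "u < n" for u
  proof -
    have "exp (- (d * (\<Sum>i<t. X i u))) * exp (- d * x u) \<le> (1 - y u) * exp (- d * x u)"
      using X(2)[OF u] by (intro mult_right_mono) auto
    moreover have "exp (- (d * (\<Sum>i<t. X i u))) * exp (- d * x u) =
        exp (- (d * (\<Sum>i<Suc t. (X(t := x)) i u)))"
      by (simp add: exp_add[symmetric] algebra_simps)
    ultimately show ?thesis using step(3)[OF u] by linarith
  qed
  moreover have "\<forall>i<Suc t. (X(t := x)) i \<in> P" using X(1) x by (simp add: less_Suc_eq)
  moreover have "\<forall>u<n. u \<notin> admissible n opt \<longrightarrow> z u = 0"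
    using z zx yA by (simp add: greedy_move_def greedy_step_def)
  ultimately show ?thesis unfolding greedy_reachable_def using step by blast
qed

text \<open>With \<open>c\<close> the sum of the answers scaled by the step size,
  \<open>c / T\<close> is their average and lies in \<open>P\<close> when \<open>T > 0\<close>. The
  bound \<open>1 - exp (- c) \<le> c\<close> then gives (a), and the sharper exponential form gives
  (b).\<close>

lemma greedy_reachable_result:
  assumes n: "n \<ge> 1" and P: "cube_polytope n P" "down_monotone n P" and T: "0 \<le> T"
    and y: "greedy_reachable n P A (T / real n ^ 4) (n ^ 4) y"
  defines "x \<equiv> \<lambda>u\<in>{..<n}. y u"
  shows "x \<in> cube n" "(\<lambda>u\<in>{..<n}. x u / T) \<in> P" "T \<le> T_bound n P \<Longrightarrow> x \<in> P"
proof -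
  have cube: "P \<subseteq> cube n" using P(1) by (auto simp: cube_polytope_def)
  have yb: "0 \<le> y u" "y u \<le> 1" if "u < n" for u using y that by (auto simp: greedy_reachable_def)
  obtain X where X: "\<And>i. i < n ^ 4 \<Longrightarrow> X i \<in> P"
    "\<And>u. u < n \<Longrightarrow> y u \<le> 1 - exp (- (T / real n ^ 4 * (\<Sum>i<n ^ 4. X i u)))"
    using y by (auto simp: greedy_reachable_def)
  define c where "c u = T / real n ^ 4 * (\<Sum>i<n ^ 4. X i u)" for u
  have avg: "(\<lambda>u\<in>{..<n}. (\<Sum>i<n ^ 4. X i u) / real (n ^ 4)) \<in> P"
    by (rule polytope_average_mem[OF P(1) X(1)]) (use n in auto)
  have c0: "0 \<le> c u" if "u < n" for u
    unfolding c_def using T cube_memD(1)[OF subsetD[OF cube X(1)] that] by (intro mult_nonneg_nonneg sum_nonneg) auto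
  have cP: "(\<lambda>u\<in>{..<n}. c u / T) \<in> P"
  proof (cases "T = 0")
    case True
    then show ?thesis using zero_mem_polytope[OF P] by simp
  next
    case False
    then have "(\<lambda>u\<in>{..<n}. c u / T) = (\<lambda>u\<in>{..<n}. (\<Sum>i<n ^ 4. X i u) / real (n ^ 4))"
      by (simp add: c_def)
    then show ?thesis using avg by simp
  qed
  show "x \<in> cube n" using yb by (simp add: x_def cube_def)
  show "(\<lambda>u\<in>{..<n}. x u / T) \<in> P"
  proof (rule down_monotoneD[OF P(2) cube cP])
    fix u assume u: "u < n"
    have "y u \<le> c u" using X(2)[OF u] exp_ge_add_one_self[of "- c u"] by (simp add: c_def)
    then show "0 \<le> (\<lambda>u\<in>{..<n}. x u / T) u \<and> (\<lambda>u\<in>{..<n}. x u / T) u \<le> (\<lambda>u\<in>{..<n}. c u / T) u"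
      using u T yb(1)[OF u] by (simp add: x_def divide_right_mono)
  qed simp
  show "x \<in> P" if "T \<le> T_bound n P"
    by (rule exp_average_mem[OF n P T that c0 cP])
       (use yb X(2) in \<open>auto simp: x_def c_def\<close>)
qed

lemma marginal_second_moment:
  assumes f: "nonnegative n f" "submodular n f" and n: "n \<ge> 1" and A: "A \<subseteq> {..<n}" "j \<in> A"
    and V: "f {} \<le> V" "\<And>u. u \<in> A \<Longrightarrow> f {u} \<le> V"
    and y: "fractional n y" "\<And>u. u < n \<Longrightarrow> u \<notin> A \<Longrightarrow> y u = 0"
  shows "multilinear n (\<lambda>S. (f (insert j S) - f (S - {j}))\<^sup>2) y \<le> (real n * V)\<^sup>2"
proof -
  have b: "0 \<le> f S \<and> f S \<le> real n * V" if "S \<subseteq> A" for S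
  proof -
    have "S \<subseteq> {..<n}" using that A by blast
    then show ?thesis
      using submodular_le_card[OF f, of S V] f(1) n V that unfolding nonnegative_def by blast
  qed
  have "multilinear n (\<lambda>S. (f (insert j S) - f (S - {j}))\<^sup>2) y =
      multilinear n (\<lambda>S. (f (insert j (S \<inter> A)) - f (S \<inter> A - {j}))\<^sup>2) y"
    using multilinear_restrict_support[OF y(1), of A "\<lambda>S. (f (insert j S) - f (S - {j}))\<^sup>2"] y(2) by simp
  also have "\<dots> \<le> multilinear n (\<lambda>_. (real n * V)\<^sup>2) y"
  proof (rule multilinear_mono)
    fix S
    have "insert j (S \<inter> A) \<subseteq> A" "S \<inter> A - {j} \<subseteq> A" using A by blast+
    then have "\<bar>f (insert j (S \<inter> A)) - f (S \<inter> A - {j})\<bar> \<le> \<bar>real n * V\<bar>"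
      using b[of "insert j (S \<inter> A)"] b[of "S \<inter> A - {j}"] by linarith
    then show "(f (insert j (S \<inter> A)) - f (S \<inter> A - {j}))\<^sup>2 \<le> (real n * V)\<^sup>2"
      by (simp only: abs_le_square_iff)
  qed
  finally show ?thesis by simp
qed

text \<open>Since \<open>d * (V - 2 * F)\<close> equals \<open>2 * d * (V / 2 - F)\<close>, the
  distance to \<open>V / 2\<close> contracts by \<open>1 - 2 * d\<close> up to \<open>err\<close>;
  the factor lies in the unit interval, so the errors at most add up.\<close>

lemma greedy_gap_Suc:
  fixes d V F F' err :: real
  assumes "F + d * (V - 2 * F) - err \<le> F'" "V / 2 - F \<le> (1 - 2 * d) ^ t * (V / 2) + real t * err"
    and "0 \<le> d" "2 * d \<le> 1" "0 \<le> err"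
  shows "V / 2 - F' \<le> (1 - 2 * d) ^ Suc t * (V / 2) + real (Suc t) * err"
proof -
  have "V / 2 - F' \<le> (1 - 2 * d) * (V / 2 - F) + err" using assms(1) by (simp add: algebra_simps)
  also have "\<dots> \<le> (1 - 2 * d) * ((1 - 2 * d) ^ t * (V / 2) + real t * err) + err"
    using assms by (intro add_right_mono mult_left_mono) auto
  also have "(1 - 2 * d) * (real t * err) \<le> 1 * (real t * err)"
    using assms by (intro mult_right_mono) auto
  then have "(1 - 2 * d) * ((1 - 2 * d) ^ t * (V / 2) + real t * err) + err
      \<le> (1 - 2 * d) ^ Suc t * (V / 2) + real (Suc t) * err"
    by (simp add: distrib_left distrib_right mult.assoc)
  finally show ?thesis .
qed

text \<open>Compare the optimizer's answer with the indicator \<open>z\<close> of \<open>B\<close>;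
  coordinates outside \<open>A\<close> have non-positive weight and can be discarded from the
  answer.\<close>

lemma optimizer_weights:
  assumes opt: "linear_optimizer n P opt" and P: "P \<subseteq> cube n"
    and z: "z \<in> P" "\<And>u. u < n \<Longrightarrow> z u = of_bool (u \<in> B)" and B: "B \<subseteq> A" "A \<subseteq> {..<n}"
    and y: "fractional n y" and e: "\<And>u. u < n \<Longrightarrow> u \<notin> A \<Longrightarrow> e u \<le> 0"
  defines "x \<equiv> opt (\<lambda>v\<in>{..<n}. (1 - y v) * e v)"
  shows "(\<Sum>u\<in>B. (1 - y u) * e u) \<le> (\<Sum>u\<in>A. (1 - y u) * e u * x u)"
proof -
  let ?w = "\<lambda>v\<in>{..<n}. (1 - y v) * e v"
  have x: "x \<in> P" unfolding x_def by (rule linear_optimizerD[OF opt])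
  have "(\<Sum>u\<in>B. (1 - y u) * e u) = (\<Sum>u<n. ?w u * z u)"
    by (rule sum.mono_neutral_cong_left) (use B z(2) in auto)
  also have "\<dots> \<le> (\<Sum>u<n. ?w u * x u)" unfolding x_def by (rule linear_optimizerD(2)[OF opt z(1)])
  also have "\<dots> = (\<Sum>u<n. (1 - y u) * e u * x u)" by (rule sum.cong) auto
  also have "\<dots> = (\<Sum>u\<in>A. (1 - y u) * e u * x u) + (\<Sum>u\<in>{..<n} - A. (1 - y u) * e u * x u)"
    using B(2) by (subst sum.subset_diff[of A]) auto
  also have "(\<Sum>u\<in>{..<n} - A. (1 - y u) * e u * x u) \<le> 0"
    using y e cube_memD[OF subsetD[OF P x]]
    by (intro sum_nonpos) (auto simp: mult_nonneg_nonpos mult_nonpos_nonneg)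
  finally show ?thesis by simp
qed

text \<open>The potential is the indicator that the gap bound has failed. Each step raises its
  expectation by at most the probability bound for an inaccurate estimate, and the bounds sum to
  \<open>1 / real n\<close>.\<close>

lemma ensures_greedy:
  fixes f :: "nat set \<Rightarrow> real" and T :: real
  assumes n: "n \<ge> 1" and f: "nonnegative n f" "symmetric n f" "submodular n f"
    and P: "cube_polytope n P" "down_monotone n P" and opt: "linear_optimizer n P opt" and T: "0 \<le> T"
  defines "V \<equiv> Max (multilinear n f ` (P \<inter> ({..<n} \<rightarrow>\<^sub>E {0, 1})))"
    and "d \<equiv> T / real n ^ 4"
  defines "err \<equiv> 3 * d * V / real n + 3 * real n ^ 3 * d\<^sup>2 * V"
  shows "0 \<le> V" and "ensures (run n f opt (rep 4 step) (init n T))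
    (\<lambda>s. greedy_reachable n P (admissible n opt) d (n ^ 4) (arr s 1))
    (\<lambda>s. of_bool (2 * d \<le> 1 \<and> 0 < V \<and>
      \<not> V / 2 - multilinear n f (arr s 1) \<le> (1 - 2 * d) ^ (n ^ 4) * (V / 2) + real (n ^ 4) * err))
    (1 / real n)"
proof -
  define A where "A = admissible n opt"
  have cube: "P \<subseteq> cube n" using P(1) by (auto simp: cube_polytope_def)
  obtain z B where z: "z \<in> P" "\<And>u. u < n \<Longrightarrow> z u = of_bool (u \<in> B)" and B: "B \<subseteq> A" "f B = V"
    and V: "f {} \<le> V" "\<And>u. u \<in> A \<Longrightarrow> f {u} \<le> V"
    unfolding A_def V_def using integral_optimum[OF P opt, of f] by blast
  have A: "A \<subseteq> {..<n}" by (auto simp: A_def admissible_def)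
  show V0: "0 \<le> V" using V(1) f(1) unfolding nonnegative_def by force
  have d: "0 \<le> d" using T by (simp add: d_def)
  have err: "0 \<le> err" using d V0 by (simp add: err_def)
  \<comment> \<open>The accuracy \<open>V / n^2\<close> turns the estimation error
    \<open>3 * real n * h * d\<close> into the first term of \<open>err\<close>. For
    \<open>V = 0\<close> the potential is 0 and \<open>h\<close> only has to be positive.\<close>
  define h where "h = (if 0 < V then V / real n ^ 2 else 1)"
  have h: "0 < h" using n by (simp add: h_def)
  define gap where "gap t y \<longleftrightarrow> V / 2 - multilinear n f y \<le> (1 - 2 * d) ^ t * (V / 2) + real t * err" for t y
  define I where "I t s \<longleftrightarrow> idx s 0 = n \<and> arr s 0 0 = T \<and> (\<forall>v<n. arr s 3 v = 0) \<and>
    greedy_reachable n P A d t (arr s 1)" for t and s :: state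
  define \<Phi> :: "nat \<Rightarrow> state \<Rightarrow> real" where
    "\<Phi> t s = of_bool (2 * d \<le> 1 \<and> 0 < V \<and> \<not> gap t (arr s 1))" for t s
  \<comment> \<open>The Chebyshev bound for one estimate; for \<open>V > 0\<close> it is
    \<open>1 / n^6\<close>, and \<open>n\<close> estimates in each of \<open>n^4\<close> steps give
    \<open>1 / n\<close>.\<close>
  define p where "p = (real n * V)\<^sup>2 / (real n ^ 12 * h\<^sup>2)"
  have move: "ensures (run n f opt step s) (I (Suc t)) (\<Phi> (Suc t)) (\<Phi> t s + real n * p)" if I: "I t s" for t s
  proof -
    define y where "y = arr s 1"
    have y: "fractional n y" "\<And>u. u < n \<Longrightarrow> u \<notin> A \<Longrightarrow> y u = 0"
      and reach: "greedy_reachable n P A d t y"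
      using I by (auto simp: I_def greedy_reachable_def y_def)
    have sT: "arr s 0 0 / real n ^ 4 = d" using I by (simp add: I_def d_def)
    let ?move = "greedy_move n opt d y"
    have "ensures (run n f opt step s)
      (\<lambda>s'. idx s' 0 = n \<and> arr s' 0 = arr s 0 \<and> (\<forall>v<n. arr s' 3 v = 0) \<and> (\<exists>e. ?move e (arr s' 1)))
      (\<lambda>s'. of_bool (\<not> (\<exists>e. ?move e (arr s' 1) \<and> \<not> inaccurate n f opt h y n e))) (real n * p)"
      using ensures_step[of s n h "(real n * V)\<^sup>2" opt f]
        marginal_second_moment[OF f(1,3) n A _ V y] I h
      unfolding sT y_def p_def I_def A_def by simp
    from ensures_affine[OF this, of 1 "\<Phi> t s"] show ?thesis
    proof (rule ensures_mono)
      fix s' :: state assume s': "idx s' 0 = n \<and> arr s' 0 = arr s 0 \<and> (\<forall>v<n. arr s' 3 v = 0) \<and> (\<exists>e. ?move e (arr s' 1))"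
      then obtain e where "?move e (arr s' 1)" by blast
      then have "greedy_reachable n P A d (Suc t) (arr s' 1)"
        using greedy_reachable_Suc[OF reach[unfolded A_def] _ cube opt d] by (simp add: A_def)
      then show "I (Suc t) s'" using s' I by (simp add: I_def)
      have "gap (Suc t) (arr s' 1)"
        if g: "2 * d \<le> 1" "0 < V" "gap t y" and e: "?move e (arr s' 1)" "\<not> inaccurate n f opt h y n e" for e
      proof -
        define x where "x = opt (\<lambda>v\<in>{..<n}. (1 - y v) * e v)"
        have x: "x \<in> P" unfolding x_def by (rule linear_optimizerD[OF opt])
        have eA: "e u = -1" if "u < n" "u \<notin> A" for u using e(1) that by (simp add: greedy_move_def A_def)
        have acc: "\<bar>e u - marginal n f u y\<bar> \<le> h" if "u \<in> A" for u
          using e(2) that A by (force simp: inaccurate_def A_def)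
        have "(\<Sum>u\<in>B. (1 - y u) * e u) \<le> (\<Sum>u\<in>A. (1 - y u) * e u * x u)"
          unfolding x_def by (rule optimizer_weights[OF opt cube z B(1) A y(1)]) (simp_all add: eA)
        moreover have "multilinear n f (arr s' 1) = multilinear n f (greedy_step d e x y)"
          by (rule multilinear_cong) (use e(1) in \<open>simp_all add: greedy_move_def x_def\<close>)
        moreover have "fractional n x" using cube_memD[OF subsetD[OF cube x]] by blast
        ultimately have gain: "multilinear n f y + d * (V - 2 * multilinear n f y)
            - (3 * real n * h * d + 3 * real n ^ 3 * d\<^sup>2 * V) \<le> multilinear n f (arr s' 1)"
          using greedy_step_gain[OF f n y A B(1) V less_imp_le[OF h] acc, of x d] eA d B(2) by simp
        have "3 * real n * h * d + 3 * real n ^ 3 * d\<^sup>2 * V = err"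
          using g(2) n by (simp add: h_def err_def power2_eq_square)
        then show ?thesis
          using greedy_gap_Suc[of "multilinear n f y" d V err "multilinear n f (arr s' 1)" t] gain g d err
          unfolding gap_def by simp
      qed
      \<comment> \<open>A failure at \<open>Suc t\<close> either was present at \<open>t\<close> or
        comes from inaccurate estimates in this step.\<close>
      then show "\<Phi> (Suc t) s' \<le> \<Phi> t s + 1 * of_bool (\<not> (\<exists>e. ?move e (arr s' 1) \<and> \<not> inaccurate n f opt h y n e))"
        unfolding \<Phi>_def y_def by auto
    qed simp_all
  qed
  have "I 0 (init n T)"
    using n by (auto simp: I_def init_def greedy_reachable_def)
  then have loop: "ensures (run n f opt (rep 4 step) (init n T)) (I (0 + n ^ 4)) (\<Phi> (0 + n ^ 4))
      (\<Phi> 0 (init n T) + real n ^ 4 * (real n * p))"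
    by (intro ensures_rep[where I = I and \<Phi> = \<Phi>, OF move]) (simp_all add: I_def \<Phi>_def)
  \<comment> \<open>Initially the gap bound reads \<open>V / 2 - F \<le> V / 2\<close>, which is
    non-negativity of the extension.\<close>
  have "\<Phi> 0 (init n T) = 0"
    using multilinear_bounds(1)[of n 0 f "Max (f ` Pow {..<n})" "arr (init n T) 1"] f(1)
    by (simp add: \<Phi>_def gap_def nonnegative_def)
  moreover have "real n ^ 4 * (real n * p) \<le> 1 / real n"
  proof (cases "0 < V")
    case True
    then have "p = 1 / real n ^ 6"
      using n by (simp add: p_def h_def power_mult_distrib power_divide field_simps flip: power_add power_mult)
    then show ?thesis using n by (simp add: eval_nat_numeral)
  next
    case False
    then have "p = 0" using V0 by (simp add: p_def)
    then show ?thesis by simp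
  qed
  ultimately have bound: "\<Phi> 0 (init n T) + real n ^ 4 * (real n * p) \<le> 1 / real n" by simp
  show "ensures (run n f opt (rep 4 step) (init n T))
    (\<lambda>s. greedy_reachable n P (admissible n opt) d (n ^ 4) (arr s 1))
    (\<lambda>s. of_bool (2 * d \<le> 1 \<and> 0 < V \<and>
      \<not> V / 2 - multilinear n f (arr s 1) \<le> (1 - 2 * d) ^ (n ^ 4) * (V / 2) + real (n ^ 4) * err))
    (1 / real n)"
    by (rule ensures_mono[OF loop _ _ bound]) (auto simp: I_def \<Phi>_def gap_def A_def)
qed

section \<open>Uniform running time and the choice of the error term\<close>

lemma linear_loops_rep: "linear_loops c \<Longrightarrow> linear_loops (rep k c)"
  by (induction k) auto

lemma linear_loops_step: "linear_loops step"
  by (simp add: step_def estimate_def sample_def draw_def update_def Let_def linear_loops_rep)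

theorem theorem1p1:
  shows "\<exists>alg :: prog. \<forall>T :: real. T \<ge> 0 \<longrightarrow>
    (\<exists>(q :: nat poly) (\<epsilon> :: nat \<Rightarrow> real). \<epsilon> \<longlonglongrightarrow> 0 \<and>
      (\<forall>(n :: nat) (f :: nat set \<Rightarrow> real) (P :: (nat \<Rightarrow> real) set)
          (opt :: (nat \<Rightarrow> real) \<Rightarrow> (nat \<Rightarrow> real)).
        n \<ge> 1 \<and> nonnegative n f \<and> symmetric n f \<and> submodular n f \<and>
        cube_polytope n P \<and> down_monotone n P \<and> linear_optimizer n P opt \<longrightarrow>
        (\<forall>s \<in> set_pmf (run n f opt alg (init n T)).
           steps s \<le> poly q n \<and>
           result n s \<in> cube n \<and>
           (\<lambda>u\<in>{..<n}. result n s u / T) \<in> P \<and>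
           (T \<le> T_bound n P \<longrightarrow> result n s \<in> P)) \<and>
        measure_pmf.prob (run n f opt alg (init n T))
          {s. multilinear n f (result n s) \<ge>
                1 / 2 * (1 - exp (- 2 * T) - \<epsilon> n) *
                  Max (multilinear n f ` (P \<inter> ({..<n} \<rightarrow>\<^sub>E {0, 1})))}
          \<ge> 1 - 1 / real n))"
proof -
  obtain q :: "nat poly" where q: "\<And>n f opt s s'. s' \<in> set_pmf (run n f opt (rep 4 step) s) \<Longrightarrow>
      steps s' \<le> steps s + poly q (idx s 0)"
    using steps_polynomial[OF linear_loops_rep[OF linear_loops_step, of 4]] by blast
  show ?thesis
  \<comment> \<open>The error term is \<open>2 / V\<close> times the error accumulated over
    \<open>n^4\<close> steps. For \<open>2 * T > n^4\<close>, which happens for finitely many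
    \<open>n\<close> only, the contraction factor could be negative, and the value 1 makes the
    guarantee trivial.\<close>
  proof (intro exI[of _ "rep 4 step"] allI impI exI[of _ q]
      exI[of _ "\<lambda>n. if 2 * T \<le> real n ^ 4 then 6 * (T + T\<^sup>2) / real n else 1" for T] conjI)
    fix T :: real assume T: "0 \<le> T"
    let ?\<epsilon> = "\<lambda>n. if 2 * T \<le> real n ^ 4 then 6 * (T + T\<^sup>2) / real n else 1"
    have "(\<lambda>n. 6 * (T + T\<^sup>2) / real n) \<longlonglongrightarrow> 0" by (rule lim_const_over_n)
    moreover have "eventually (\<lambda>n. 6 * (T + T\<^sup>2) / real n = ?\<epsilon> n) sequentially"
      using eventually_ge_at_top[of "nat \<lceil>2 * T\<rceil>"] eventually_ge_at_top[of 1]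
    proof eventually_elim
      case (elim n)
      have "2 * T \<le> real n" using elim(1) by linarith
      also have "\<dots> \<le> real n ^ 4" using elim(2) by (intro self_le_power) auto
      finally show ?case by simp
    qed
    ultimately show "?\<epsilon> \<longlonglongrightarrow> 0" by (rule Lim_transform_eventually)
    fix n f P opt
    assume asm: "n \<ge> 1 \<and> nonnegative n f \<and> symmetric n f \<and> submodular n f \<and>
        cube_polytope n P \<and> down_monotone n P \<and> linear_optimizer n P opt"
    then have n: "n \<ge> 1" and f: "nonnegative n f" "symmetric n f" "submodular n f"
      and P: "cube_polytope n P" "down_monotone n P" and opt: "linear_optimizer n P opt" by auto
    define M where "M = run n f opt (rep 4 step) (init n T)"
    define V where "V = Max (multilinear n f ` (P \<inter> ({..<n} \<rightarrow>\<^sub>E {0, 1})))"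
    define d where "d = T / real n ^ 4"
    define err where "err = 3 * d * V / real n + 3 * real n ^ 3 * d\<^sup>2 * V"
    define bad where "bad = {s :: state. 2 * d \<le> 1 \<and> 0 < V \<and>
      \<not> V / 2 - multilinear n f (arr s 1) \<le> (1 - 2 * d) ^ (n ^ 4) * (V / 2) + real (n ^ 4) * err}"
    note greedy = ensures_greedy[OF n f P opt T, folded V_def d_def, folded err_def M_def]
    have V0: "0 \<le> V" by (rule greedy(1))
    have reach: "greedy_reachable n P (admissible n opt) d (n ^ 4) (arr s 1)" if "s \<in> set_pmf M" for s
      using greedy(2) that by (simp add: ensures_def)
    have res: "result n s = (\<lambda>u\<in>{..<n}. arr s 1 u)" for s by (simp add: result_def read_vec_def)
    have "steps s \<le> poly q n \<and> result n s \<in> cube n \<and> (\<lambda>u\<in>{..<n}. result n s u / T) \<in> P \<and>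
        (T \<le> T_bound n P \<longrightarrow> result n s \<in> P)" if s: "s \<in> set_pmf M" for s
    proof -
      have "steps s \<le> poly q n" using q[OF s[unfolded M_def]] by (simp add: init_def)
      then show ?thesis
        using greedy_reachable_result[OF n P T reach[OF s, unfolded d_def]] unfolding res by blast
    qed
    then show "\<forall>s \<in> set_pmf (run n f opt (rep 4 step) (init n T)).
        steps s \<le> poly q n \<and> result n s \<in> cube n \<and> (\<lambda>u\<in>{..<n}. result n s u / T) \<in> P \<and>
        (T \<le> T_bound n P \<longrightarrow> result n s \<in> P)"
      unfolding M_def by blast
    have good: "1 / 2 * (1 - exp (- 2 * T) - ?\<epsilon> n) * V \<le> multilinear n f (result n s)" if "s \<notin> bad" for s
    proof -
      have F: "multilinear n f (result n s) = multilinear n f (arr s 1)"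
        unfolding res by (rule multilinear_cong) auto
      have F0: "0 \<le> multilinear n f (result n s)"
        using multilinear_mono[of n "\<lambda>_. 0" f "result n s"] f(1) by (simp add: nonnegative_def)
      show ?thesis
      proof (cases "2 * T \<le> real n ^ 4 \<and> 0 < V")
        case True
        then have d: "2 * d \<le> 1" using n by (simp add: d_def)
        have "(1 - 2 * d) ^ (n ^ 4) \<le> exp (- 2 * d) ^ (n ^ 4)"
          using exp_ge_add_one_self[of "- 2 * d"] d by (intro power_mono) auto
        also have "\<dots> = exp (- 2 * T)" using n by (simp add: exp_of_nat_mult[symmetric] d_def)
        finally have "(1 - 2 * d) ^ (n ^ 4) * (V / 2) \<le> exp (- 2 * T) * (V / 2)"
          using V0 by (intro mult_right_mono) auto
        moreover have "real (n ^ 4) * err = ?\<epsilon> n * V / 2"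
          using n True by (simp add: err_def d_def field_simps eval_nat_numeral)
        moreover have "V / 2 - multilinear n f (arr s 1) \<le> (1 - 2 * d) ^ (n ^ 4) * (V / 2) + real (n ^ 4) * err"
          using that d True by (simp add: bad_def)
        ultimately show ?thesis unfolding F by (simp add: algebra_simps)
      next
        \<comment> \<open>Either the error term is 1 and the factor is non-positive, or
          \<open>V = 0\<close>; the extension is non-negative in any case.\<close>
        case False
        then have "(1 - exp (- 2 * T) - ?\<epsilon> n) * V \<le> 0" using V0 by (cases "V = 0") (auto simp: mult_le_0_iff)
        then show ?thesis using F0 by simp
      qed
    qed
    \<comment> \<open>The expectation of the failure indicator is the failure probability, and the
      desired event contains the complement of \<open>bad\<close>.\<close>
    have "measure_pmf.expectation M (\<lambda>s. of_bool (s \<in> bad)) \<le> 1 / real n"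
      using greedy(2) by (simp add: ensures_def bad_def)
    moreover have "measure_pmf.expectation M (\<lambda>s. of_bool (s \<in> bad)) = measure_pmf.prob M bad"
      by (simp add: indicator_def[symmetric])
    ultimately have "1 - 1 / real n \<le> 1 - measure_pmf.prob M bad" by simp
    also have "\<dots> = measure_pmf.prob M (- bad)" using measure_pmf.prob_compl[of bad M] by (simp add: Compl_eq_Diff_UNIV)
    also have "\<dots> \<le> measure_pmf.prob M {s. multilinear n f (result n s) \<ge> 1 / 2 * (1 - exp (- 2 * T) - ?\<epsilon> n) * V}"
      using good by (intro measure_pmf.finite_measure_mono) auto
    finally show "measure_pmf.prob (run n f opt (rep 4 step) (init n T))
          {s. multilinear n f (result n s) \<ge> 1 / 2 * (1 - exp (- 2 * T) - ?\<epsilon> n) *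
                  Max (multilinear n f ` (P \<inter> ({..<n} \<rightarrow>\<^sub>E {0, 1})))} \<ge> 1 - 1 / real n"
      unfolding M_def V_def .
  qed
qed

end
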